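(* Let $k\geq 2$ be an integer and let $\boldsymbol{S}\subset\mathbb{Z}^2$ be a finite set of integer lattice points whose elements are pairwise $k$-visible to each other, with $N=\#\boldsymbol{S}<2^{k+1}$. Then for real $x\geq 2$, $$N^1_k(\boldsymbol{S},x)=x^2\prod_p\Bigl(1-\frac{N}{p^{k+1}}\Bigr)+E_1(x),$$ where $p$ runs over all primes and $$E_1(x)=\begin{cases} O_k(x\log^N x), & \text{if } 1\le N\le k,\\ O_{k,\varepsilon}\bigl(x^{2-\frac{2k}{N+k}+\varepsilon}\bigr) \text{ for every } \varepsilon>0, & \text{if } k<N<2^{k+1}.\end{cases}$$
   Context: $\mathbb{N}$ denotes the positive integers. For a positive integer $k$ and integer lattice points $(u,v),(m,n)$ with $m\neq u$, let $r\in\mathbb{Q}$ be given by $n-v=r(m-u)^k$ and let $\mathcal{C}$ be the curve $y-v=r(x-u)^k$. The point $(m,n)$ is called ($k$-)visible, or Level-1 $k$-visible, to $(u,v)$ if there is no integer lattice point lying on the segment of $\mathcal{C}$ strictly between $(u,v)$ and $(m,n)$ (i.e. no integer point $(x,y)$ on $\mathcal{C}$ with $x$ strictly between $u$ and $m$); the curve is only defined when $m\neq u$, and pairs with $m=u$ are not regarded as $k$-visible. This relation is symmetric. For a set $\boldsymbol{S}$ of lattice points, $\boldsymbol{V}_k^1(\boldsymbol{S})=\{(m,n)\in\mathbb{N}\times\mathbb{N}: (m,n)\text{ is } k\text{-visible to every point of }\boldsymbol{S}\}$, and $N^1_k(\boldsymbol{S},x)=\#\{(m,n)\in\boldsymbol{V}_k^1(\boldsymbol{S}):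 m,n\le x\}$. The notation $f=O_\rho(g)$ means $|f|\le Cg$ with $C$ depending only on the parameters $\rho$.
   Formalization: A constant depending only on k (or k, ε) for all S and all x ≥ 2 is impossible, even for N = 1; proved here: such a constant for x ≥ 2 at least as large as all |coordinates| of points of S, and for each fixed S the bound for all x ≥ 2 with a constant that may depend on S. *)

theory Defs
  imports "HOL-Analysis.Analysis" "HOL-Computational_Algebra.Primes"
begin

definition on_curve :: "nat \<Rightarrow> rat \<Rightarrow> int \<times> int \<Rightarrow> int \<times> int \<Rightarrow> bool" where
  "on_curve k r = (\<lambda>(u, v) (x, y). of_int (y - v) = r * of_int (x - u) ^ k)"

text \<open>\<open>k_visible k P Q\<close> reads ``\<open>P\<close> is (Level-1) \<open>k\<close>-visible to \<open>Q\<close>''. For \<open>m \<noteq> u\<close> the slope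
  \<open>r\<close> is uniquely determined, so the existential quantifier merely names it.\<close>

definition k_visible :: "nat \<Rightarrow> int \<times> int \<Rightarrow> int \<times> int \<Rightarrow> bool" where
  "k_visible k = (\<lambda>(m, n) (u, v). m \<noteq> u \<and>
     (\<exists>r. on_curve k r (u, v) (m, n) \<and>
       \<not> (\<exists>x y. min u m < x \<and> x < max u m \<and> on_curve k r (u, v) (x, y))))"

definition visible_set :: "nat \<Rightarrow> (int \<times> int) set \<Rightarrow> (int \<times> int) set" where
  "visible_set k S = {(m, n). m \<ge> 1 \<and> n \<ge> 1 \<and> (\<forall>P\<in>S. k_visible k (m, n) P)}"

definition visible_count :: "nat \<Rightarrow> (int \<times> int) set \<Rightarrow> real \<Rightarrow> nat" where
  "visible_count k S x =
     card {(m, n). (m, n) \<in> visible_set k S \<and> of_int m \<le> x \<and> of_int n \<le> x}"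

definition visible_error :: "nat \<Rightarrow> (int \<times> int) set \<Rightarrow> real \<Rightarrow> real" where
  "visible_error k S x = real (visible_count k S x) -
     x\<^sup>2 * (\<Prod>p::nat. if prime p then 1 - real (card S) / real p ^ (k + 1) else 1)"

end

theory Submission
  imports Defs "HOL-Number_Theory.Cong"
begin

text \<open>
  A point \<open>(m, n)\<close> with \<open>m \<noteq> u\<close> is \<open>k\<close>-visible to \<open>(u, v)\<close> iff no prime \<open>p\<close> satisfies both
  \<open>p dvd m - u\<close> and \<open>p ^ k dvd n - v\<close>. Moebius inversion for each of the \<open>N\<close> points of \<open>S\<close> writes the
  count as a signed sum over \<open>N\<close>-tuples of squarefree numbers \<open>d_P\<close>; pairwise visibility makes tuples
  that are not pairwise coprime contribute nothing, and for the others the Chinese remainder theorem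
  gives \<open>x^2 / d^(k+1) + O(x/d + 1)\<close> with \<open>d\<close> the product of the \<open>d_P\<close>. Only tuples with all
  \<open>d_P \<le> z\<close> are used. Extending the main term to the Euler product costs \<open>O(x^2 / z^k)\<close>, the points
  where some \<open>d_P > z\<close> matters cost \<open>O(x^2 / z^k)\<close> times a divisor bound \<open>x^\<epsilon>\<close>, and the remainders
  add up to \<open>O(x log^N z + z^N)\<close>. For \<open>N \<le> k\<close> one takes \<open>z = (2x)^(1/k)\<close>, where nothing is truncated
  because \<open>d_P^k \<le> \<bar>n - v\<bar> \<le> 2x\<close>; for \<open>N > k\<close> the choice \<open>z = x^(2/(N+k))\<close> balances
  \<open>z^N\<close> against \<open>x^2 / z^k\<close>.

  A squarefree number is represented by its set \<open>A\<close> of prime factors, so that it is \<open>\<Prod>A\<close> and its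
  Moebius value is \<open>(-1) ^ card A\<close>.
\<close>

section \<open>Visibility and sets of primes\<close>

lemma prime_dvd_prod_primes_iff:
  fixes A :: "nat set"
  assumes "finite A" "\<And>p. p \<in> A \<Longrightarrow> prime p" "prime q"
  shows "q dvd \<Prod>A \<longleftrightarrow> q \<in> A"
  using assms by (auto simp: prime_dvd_prod_iff) (metis primes_dvd_imp_eq, meson dvd_refl)

text \<open>The set is recovered as the prime divisors of its product. Through this, sums over sets
  of primes are bounded by sums over integers.\<close>

lemma inj_on_prod_primes: "inj_on (\<lambda>A. \<Prod>A) {A :: nat set. finite A \<and> (\<forall>p\<in>A. prime p)}"
proof (rule inj_onI)
  fix A B :: "nat set"
  assume A: "A \<in> {A. finite A \<and> (\<forall>p\<in>A. prime p)}" and B: "B \<in> {A. finite A \<and> (\<forall>p\<in>A. prime p)}"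
    and eq: "\<Prod>A = \<Prod>B"
  have "q \<in> A \<longleftrightarrow> q \<in> B" if "prime q" for q
    using that A B eq prime_dvd_prod_primes_iff[of A q] prime_dvd_prod_primes_iff[of B q] by auto
  with A B show "A = B" by auto
qed

lemma prod_primes_pos:
  fixes A :: "nat set"
  assumes "\<And>p. p \<in> A \<Longrightarrow> prime p"
  shows "\<Prod>A > 0"
  using assms by (intro prod_pos) (auto dest: prime_gt_0_nat)

lemma prod_primes_power_dvd_iff:
  fixes A :: "nat set" and n :: int
  assumes "finite A" "\<And>p. p \<in> A \<Longrightarrow> prime p"
  shows "int (\<Prod>A) ^ j dvd n \<longleftrightarrow> (\<forall>p\<in>A. int p ^ j dvd n)"
  using assms
proof (induction A rule: finite_induct)
  case (insert p A)
  have "coprime (int p) (int (\<Prod>A))"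
    unfolding of_nat_prod
    by (rule prod_coprime_right) (use insert in \<open>auto intro!: primes_coprime\<close>)
  hence "coprime (int p ^ j) (int (\<Prod>A) ^ j)" by simp
  hence "int p ^ j * int (\<Prod>A) ^ j dvd n \<longleftrightarrow> int p ^ j dvd n \<and> int (\<Prod>A) ^ j dvd n"
    by (meson divides_mult dvd_mult_left dvd_mult_right)
  with insert show ?case by (simp add: power_mult_distrib)
qed auto

text \<open>With \<open>a = m - u\<close> and \<open>b = n - v\<close>, the curve has an integer
  point at abscissa \<open>u + t\<close> iff \<open>a ^ k dvd b * t ^ k\<close>. Cancelling
  \<open>gcd a t\<close> leaves a non-unit \<open>a'\<close> with \<open>a' ^ k dvd b\<close>, and
  any prime factor of \<open>a'\<close> is an obstruction. Conversely an obstructing prime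
  \<open>p\<close> yields an integer point at \<open>t = a / p\<close>.\<close>

lemma k_visible_iff:
  "k_visible k (m, n) (u, v) \<longleftrightarrow>
    m \<noteq> u \<and> (\<forall>p::nat. prime p \<longrightarrow> \<not> (int p dvd m - u \<and> int p ^ k dvd n - v))"
proof (cases "m = u")
  case True
  thus ?thesis by (simp add: k_visible_def)
next
  case False
  define a where "a = m - u"
  define b where "b = n - v"
  have a0: "a \<noteq> 0" using False by (simp add: a_def)
  have curve: "on_curve k r (u, v) (m, n) \<longleftrightarrow> r = of_int b / of_int a ^ k" for r
    using a0 by (auto simp: on_curve_def a_def b_def field_simps)
  have pt: "on_curve k (of_int b / of_int a ^ k) (u, v) (x, y) \<longleftrightarrow> (y - v) * a ^ k = b * (x - u) ^ k" for x y
  proof -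
    have "on_curve k (of_int b / of_int a ^ k) (u, v) (x, y) \<longleftrightarrow>
       (of_int ((y - v) * a ^ k) :: rat) = of_int (b * (x - u) ^ k)"
      unfolding on_curve_def using a0 by (simp add: field_simps)
    thus ?thesis by (simp only: of_int_eq_iff)
  qed
  have ex: "(\<exists>y. (y - v) * a ^ k = b * t ^ k) \<longleftrightarrow> a ^ k dvd b * t ^ k" for t
    by (metis add_diff_cancel_left' dvd_def mult.commute)
  have vis: "k_visible k (m, n) (u, v) \<longleftrightarrow>
     \<not> (\<exists>t. min 0 a < t \<and> t < max 0 a \<and> a ^ k dvd b * t ^ k)"
  proof -
    have "(\<exists>x. min u m < x \<and> x < max u m \<and> (\<exists>y. (y - v) * a ^ k = b * (x - u) ^ k)) \<longleftrightarrow>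
       (\<exists>t. min 0 a < t \<and> t < max 0 a \<and> (\<exists>y. (y - v) * a ^ k = b * t ^ k))" (is "?l \<longleftrightarrow> ?r")
    proof
      assume ?l
      then obtain x where "min u m < x \<and> x < max u m \<and> (\<exists>y. (y - v) * a ^ k = b * (x - u) ^ k)" by blast
      thus ?r by (intro exI[of _ "x - u"]) (auto simp: a_def)
    next
      assume ?r
      then obtain t where "min 0 a < t \<and> t < max 0 a \<and> (\<exists>y. (y - v) * a ^ k = b * t ^ k)" by blast
      thus ?l by (intro exI[of _ "t + u"]) (auto simp: a_def)
    qed
    moreover have "k_visible k (m, n) (u, v) \<longleftrightarrow>
      \<not> (\<exists>x. min u m < x \<and> x < max u m \<and> (\<exists>y. (y - v) * a ^ k = b * (x - u) ^ k))"
      using False by (auto simp: k_visible_def curve pt)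
    ultimately show ?thesis by (simp add: ex)
  qed
  have "(\<exists>t. min 0 a < t \<and> t < max 0 a \<and> a ^ k dvd b * t ^ k) \<longleftrightarrow>
     (\<exists>p::nat. prime p \<and> int p dvd a \<and> int p ^ k dvd b)" (is "?l \<longleftrightarrow> ?r")
  proof
    assume ?l
    then obtain t where t: "min 0 a < t" "t < max 0 a" "a ^ k dvd b * t ^ k" by blast
    define g where "g = gcd a t"
    have g0: "g \<noteq> 0" using a0 by (simp add: g_def)
    obtain a' t' where at: "a = g * a'" "t = g * t'" "coprime a' t'"
      using gcd_coprime_exists[of a t] a0 unfolding g_def by (metis gcd_eq_0_iff mult.commute)
    have "g ^ k * a' ^ k dvd g ^ k * (b * t' ^ k)"
      using t(3) by (simp add: at power_mult_distrib mult_ac)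
    hence "a' ^ k dvd b * t' ^ k" using g0 by simp
    moreover have "coprime (a' ^ k) (t' ^ k)" using at by simp
    ultimately have dv: "a' ^ k dvd b" by (simp add: coprime_dvd_mult_left_iff)
    \<comment> \<open>If \<open>a'\<close> were a unit, \<open>a\<close> would divide
      \<open>t\<close>, which is impossible because \<open>t\<close> lies strictly between 0 and
      \<open>a\<close>.\<close>
    have "\<not> a' dvd 1"
    proof
      assume "a' dvd 1"
      hence "a dvd t" using at by (metis dvd_mult dvd_mult_unit_iff' dvd_refl is_unit_mult_iff mult.commute mult_dvd_mono one_dvd dvd_trans)
      moreover have "t \<noteq> 0" "\<bar>t\<bar> < \<bar>a\<bar>" using t by auto
      ultimately show False by (simp add: zdvd_not_zless dvd_imp_le_int leD)
    qed
    hence "nat \<bar>a'\<bar> \<noteq> 1" by auto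
    then obtain p where p: "prime p" "p dvd nat \<bar>a'\<bar>" using prime_factor_nat by blast
    hence pa: "int p dvd a'" by auto
    have "int p ^ k dvd b" using dv pa by (meson dvd_power_same dvd_trans)
    thus ?r using p pa at by auto
  next
    assume ?r
    then obtain p where p: "prime p" "int p dvd a" "int p ^ k dvd b" by blast
    obtain t where t: "a = int p * t" using p(2) by blast
    obtain c where c: "b = int p ^ k * c" using p(3) by blast
    have p2: "int p \<ge> 2" using p(1) prime_ge_2_nat by auto
    have "a ^ k dvd b * t ^ k" by (simp add: t c power_mult_distrib mult_ac)
    \<comment> \<open>\<open>t\<close> has the sign of \<open>a\<close>, and
      \<open>p \<ge> 2\<close> makes it strictly smaller in absolute value.\<close>
    moreover have "min 0 a < t \<and> t < max 0 a"
    proof (cases "t > 0")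
      case True
      have "2 * t \<le> int p * t" using True p2 by (intro mult_right_mono) auto
      thus ?thesis using True t by auto
    next
      case False
      hence "t < 0" using t a0 by (cases "t = 0") auto
      moreover have "int p * t \<le> 2 * t" using \<open>t < 0\<close> p2 by (intro mult_right_mono_neg) auto
      ultimately show ?thesis using t by linarith
    qed
    ultimately show ?l by blast
  qed
  with vis False show ?thesis by (auto simp: a_def b_def)
qed

section \<open>Residue classes\<close>

lemma card_residue_class_interval:
  fixes d a :: int and x :: real
  assumes "d > 0" "x \<ge> 0"
  shows "finite {m. 1 \<le> m \<and> of_int m \<le> x \<and> d dvd m - a}"
    and "\<bar>real (card {m. 1 \<le> m \<and> of_int m \<le> x \<and> d dvd m - a}) - x / of_int d\<bar> \<le> 1"
proof -
  \<comment> \<open>The elements are \<open>a + d * j\<close>. Positivity means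
    \<open>j > - a / d\<close>, so the interval of \<open>j\<close> is open on the left. Its length
    \<open>?r - ?l\<close> differs from \<open>x / d\<close> by a difference of two fractional
    parts, hence by less than 1.\<close>
  let ?l = "\<lfloor>- of_int a / of_int d :: real\<rfloor>" and ?r = "\<lfloor>(x - of_int a) / of_int d\<rfloor>"
  have "{m. 1 \<le> m \<and> of_int m \<le> x \<and> d dvd m - a} = (\<lambda>j. a + d * j) ` {?l<..?r}"
  proof (intro equalityI subsetI)
    fix m assume "m \<in> {m. 1 \<le> m \<and> of_int m \<le> x \<and> d dvd m - a}"
    hence m: "1 \<le> m" "of_int m \<le> x" and "d dvd m - a" by auto
    then obtain j where "m - a = d * j" by blast
    hence j: "m = a + d * j" by simp
    have "(0::real) < of_int (a + d * j)" using m j by (subst of_int_0_less_iff) linarith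
    hence "?l < j" using assms(1) by (subst floor_less_iff) (simp add: field_simps)
    moreover have "j \<le> ?r" using assms(1) m(2) by (subst le_floor_iff) (simp add: j field_simps)
    ultimately show "m \<in> (\<lambda>j. a + d * j) ` {?l<..?r}" using j by auto
  next
    fix m assume "m \<in> (\<lambda>j. a + d * j) ` {?l<..?r}"
    then obtain j where "m = a + d * j" "j \<in> {?l<..?r}" by blast
    hence j: "m = a + d * j" "?l < j" "j \<le> ?r" by simp_all
    have "(0::real) < of_int (a + d * j)" using j(2) assms(1) by (simp add: floor_less_iff field_simps)
    hence "m \<ge> 1" unfolding of_int_0_less_iff using j(1) by linarith
    moreover have "of_int m \<le> x" using j(1,3) assms(1) by (simp add: le_floor_iff field_simps)
    ultimately show "m \<in> {m. 1 \<le> m \<and> of_int m \<le> x \<and> d dvd m - a}" using j(1) by auto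
  qed
  moreover have inj: "inj_on (\<lambda>j. a + d * j) {?l<..?r}" using assms(1) by (auto intro: inj_onI)
  ultimately show "finite {m. 1 \<le> m \<and> of_int m \<le> x \<and> d dvd m - a}" by simp
  have "card {m. 1 \<le> m \<and> of_int m \<le> x \<and> d dvd m - a} = nat (?r - ?l)"
    using inj \<open>_ = (\<lambda>j. a + d * j) ` {?l<..?r}\<close> by (simp add: card_image)
  moreover have "?l \<le> ?r" using assms by (intro floor_mono divide_right_mono) auto
  moreover have "(x - of_int a) / of_int d = x / of_int d + - of_int a / of_int d"
    using assms by (simp add: field_simps)
  ultimately show "\<bar>real (card {m. 1 \<le> m \<and> of_int m \<le> x \<and> d dvd m - a}) - x / of_int d\<bar> \<le> 1"
    by (simp) linarith
qed

text \<open>Merges the conditions coming from all points into a single residue class, to which the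
  interval count applies. The class \<open>a\<close> is a common solution, built one modulus at a
  time.\<close>

lemma chinese_remainder_int_ex:
  fixes m u :: "'a \<Rightarrow> int"
  assumes "finite I" "\<And>i j. i \<in> I \<Longrightarrow> j \<in> I \<Longrightarrow> i \<noteq> j \<Longrightarrow> coprime (m i) (m j)"
  shows "\<exists>a. \<forall>n. (\<forall>i\<in>I. m i dvd n - u i) \<longleftrightarrow> (\<Prod>i\<in>I. m i) dvd n - a"
  using assms
proof (induction I rule: finite_induct)
  case (insert i I)
  then obtain a where a: "\<And>n. (\<forall>j\<in>I. m j dvd n - u j) \<longleftrightarrow> (\<Prod>j\<in>I. m j) dvd n - a" by auto
  have co: "coprime (m i) (\<Prod>j\<in>I. m j)"
    using insert by (intro prod_coprime_right) auto
  then obtain b where b: "[b = u i] (mod m i)" "[b = a] (mod (\<Prod>j\<in>I. m j))"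
    using binary_chinese_remainder_int by blast
  have "(\<forall>j\<in>insert i I. m j dvd n - u j) \<longleftrightarrow> (\<Prod>j\<in>insert i I. m j) dvd n - b" for n
  proof -
    have "m i dvd n - u i \<longleftrightarrow> m i dvd n - b"
      using b(1) by (metis cong_iff_dvd_diff cong_sym cong_trans)
    moreover have "(\<Prod>j\<in>I. m j) dvd n - a \<longleftrightarrow> (\<Prod>j\<in>I. m j) dvd n - b"
      using b(2) by (metis cong_iff_dvd_diff cong_sym cong_trans)
    moreover have "m i * (\<Prod>j\<in>I. m j) dvd n - b \<longleftrightarrow> m i dvd n - b \<and> (\<Prod>j\<in>I. m j) dvd n - b"
      using co by (meson divides_mult dvd_mult_left dvd_mult_right)
    ultimately show ?thesis using a insert by simp
  qed
  thus ?case by blast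
qed auto

section \<open>Sums over sets of primes and the Euler product\<close>

text \<open>Moebius inversion in terms of prime sets: the sum expands a product of factors
  \<open>1 - 1\<close> over \<open>Q\<close>.\<close>

lemma sum_Pow_alternating:
  assumes "finite Q"
  shows "(\<Sum>A\<in>Pow Q. (-1) ^ card A :: real) = (if Q = {} then 1 else 0)"
proof -
  have "(\<Prod>q\<in>Q. 1 - 1 :: real) = (\<Sum>A\<in>Pow Q. (-1) ^ card A * (\<Prod>x\<in>A. 1) * (\<Prod>x\<in>Q-A. 1))"
    using assms by (rule prod_diff_conv_sum)
  thus ?thesis using assms by (auto simp: power_0_left)
qed

text \<open>When the product is multiplied out, each \<open>p\<close> contributes either 1 or
  \<open>- t p\<close> on behalf of exactly one of the \<open>card S\<close> points. Such choices
  are the same as disjoint families, with \<open>A P\<close> the set of primes assigned to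
  \<open>P\<close>.\<close>

lemma prod_one_minus_card_mult:
  fixes t :: "'a \<Rightarrow> real"
  assumes "finite R" "finite S"
  shows "(\<Prod>p\<in>R. 1 - real (card S) * t p) =
    (\<Sum>A\<in>{A \<in> S \<rightarrow>\<^sub>E Pow R. disjoint_family_on A S}. \<Prod>P\<in>S. (-1) ^ card (A P) * (\<Prod>p\<in>A P. t p))"
  using assms(2,1)
proof (induction S arbitrary: R rule: finite_induct)
  case (insert P S)
  let ?w = "\<lambda>B. (-1) ^ card B * (\<Prod>p\<in>B. t p) :: real"
  let ?F = "\<lambda>S R. {A \<in> S \<rightarrow>\<^sub>E Pow R. disjoint_family_on A S}"
  have fin: "finite (?F S (R - B))" for B
    using insert by (intro finite_subset[OF _ finite_PiE[of S "\<lambda>_. Pow (R - B)"]]) auto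
  \<comment> \<open>A disjoint family on \<open>insert P S\<close> amounts to its member
    \<open>B\<close> at \<open>P\<close> together with a disjoint family on \<open>S\<close> inside
    \<open>R - B\<close>.\<close>
  have img: "?F (insert P S) R = (\<lambda>(B, A). A(P := B)) ` (SIGMA B : Pow R. ?F S (R - B))"
  proof (intro equalityI subsetI)
    fix A assume A: "A \<in> ?F (insert P S) R"
    \<comment> \<open>Functions in \<open>\<rightarrow>\<^sub>E\<close> are \<open>undefined\<close>
      off the index set, so forgetting the member at \<open>P\<close> means resetting that
      value.\<close>
    have "A = (A(P := undefined))(P := A P)" by simp
    moreover have "A(P := undefined) \<in> ?F S (R - A P)"
    proof -
      have "A Q \<inter> A P = {}" if "Q \<in> S" for Q
        using A that insert.hyps by (auto simp: disjoint_family_on_def)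
      hence "A Q \<subseteq> R - A P" if "Q \<in> S" for Q
        using A that by (auto simp: PiE_def Pi_def)
      moreover have "disjoint_family_on (A(P := undefined)) S"
        using A insert.hyps by (auto simp: disjoint_family_on_def)
      ultimately show ?thesis using A insert.hyps
        by (auto simp: PiE_def extensional_def)
    qed
    moreover have "A P \<in> Pow R" using A by (auto simp: PiE_def Pi_def)
    ultimately show "A \<in> (\<lambda>(B, A). A(P := B)) ` (SIGMA B : Pow R. ?F S (R - B))"
      by (intro image_eqI[where x = "(A P, A(P := undefined))"]) auto
  next
    fix A' assume "A' \<in> (\<lambda>(B, A). A(P := B)) ` (SIGMA B : Pow R. ?F S (R - B))"
    then obtain A B where "A' = A(P := B)" "B \<subseteq> R" "A \<in> S \<rightarrow>\<^sub>E Pow (R - B)" "disjoint_family_on A S"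
      by auto
    moreover from this have sub: "A Q \<subseteq> R - B" if "Q \<in> S" for Q
      using that by (auto simp: PiE_def Pi_def)
    moreover have "disjoint_family_on (A(P := B)) (insert P S)"
      unfolding disjoint_family_on_def
    proof (intro ballI impI)
      fix Q Q' assume "Q \<in> insert P S" "Q' \<in> insert P S" "Q \<noteq> Q'"
      thus "(A(P := B)) Q \<inter> (A(P := B)) Q' = {}"
        using sub[of Q] sub[of Q'] \<open>disjoint_family_on A S\<close> insert.hyps
        by (cases "Q = P"; cases "Q' = P") (auto simp: disjoint_family_on_def)
    qed
    moreover have "A(P := B) \<in> insert P S \<rightarrow>\<^sub>E Pow R"
      using sub \<open>B \<subseteq> R\<close> \<open>A \<in> _\<close> by (auto simp: PiE_def extensional_def split: if_splits dest: subsetD[OF sub])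
    ultimately show "A' \<in> ?F (insert P S) R" by simp
  qed
  have inj: "inj_on (\<lambda>(B, A). A(P := B)) (SIGMA B : Pow R. ?F S (R - B))"
  proof (rule inj_onI, clarify)
    fix B A B' A' assume *: "A(P := B) = A'(P := B')"
      and "A \<in> S \<rightarrow>\<^sub>E Pow (R - B)" "A' \<in> S \<rightarrow>\<^sub>E Pow (R - B')"
    hence "A P = undefined" "A' P = undefined" using insert.hyps by (auto simp: PiE_def extensional_def)
    moreover have "A Q = A' Q" if "Q \<noteq> P" for Q using * that by (metis fun_upd_other)
    ultimately have "A = A'" by (metis ext)
    thus "B = B' \<and> A = A'" using * by (metis fun_upd_same)
  qed
  have "(\<Sum>A\<in>?F (insert P S) R. \<Prod>Q\<in>insert P S. ?w (A Q)) =
     (\<Sum>(B, A)\<in>(SIGMA B : Pow R. ?F S (R - B)). \<Prod>Q\<in>insert P S. ?w ((A(P := B)) Q))"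
    unfolding img by (subst sum.reindex[OF inj]) (simp add: case_prod_unfold o_def)
  also have "\<dots> = (\<Sum>B\<in>Pow R. \<Sum>A\<in>?F S (R - B). \<Prod>Q\<in>insert P S. ?w ((A(P := B)) Q))"
    using insert.prems fin by (subst sum.Sigma) auto
  also have "\<dots> = (\<Sum>B\<in>Pow R. ?w B * (\<Sum>A\<in>?F S (R - B). \<Prod>Q\<in>S. ?w (A Q)))"
  proof (rule sum.cong[OF refl])
    fix B assume "B \<in> Pow R"
    have "(\<Prod>Q\<in>insert P S. ?w ((A(P := B)) Q)) = ?w B * (\<Prod>Q\<in>S. ?w (A Q))" for A
    proof -
      have "(\<Prod>Q\<in>S. ?w ((A(P := B)) Q)) = (\<Prod>Q\<in>S. ?w (A Q))"
        by (rule prod.cong) (use insert.hyps in auto)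
      thus ?thesis using insert.hyps by (subst prod.insert) simp_all
    qed
    thus "(\<Sum>A\<in>?F S (R - B). \<Prod>Q\<in>insert P S. ?w ((A(P := B)) Q)) = ?w B * (\<Sum>A\<in>?F S (R - B). \<Prod>Q\<in>S. ?w (A Q))"
      by (simp add: sum_distrib_left)
  qed
  also have "\<dots> = (\<Sum>B\<in>Pow R. ?w B * (\<Prod>p\<in>R-B. 1 - real (card S) * t p))"
    using insert by (intro sum.cong refl arg_cong2[where f = "(*)"]) auto
  also have "\<dots> = (\<Sum>B\<in>Pow R. (\<Prod>p\<in>B. - t p) * (\<Prod>p\<in>R-B. 1 - real (card S) * t p))"
    by (simp add: prod_uminus)
  \<comment> \<open>Summing over \<open>B\<close> chooses for each prime between the new point
    \<open>P\<close> and the factor left over for \<open>S\<close>.\<close>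
  also have "\<dots> = (\<Prod>p\<in>R. - t p + (1 - real (card S) * t p))"
    by (rule prod_add[symmetric]) fact
  also have "\<dots> = (\<Prod>p\<in>R. 1 - real (card (insert P S)) * t p)"
    using insert.hyps by (intro prod.cong) (auto simp: algebra_simps)
  finally show ?case by simp
next
  case empty
  show ?case by (simp add: disjoint_family_on_def)
qed

section \<open>Elementary estimates for sums over integers\<close>

lemma sum_inverse_power_tail:
  fixes z :: real and D :: "nat set"
  assumes "finite D" "z \<ge> 1" "\<And>d. d \<in> D \<Longrightarrow> real d > z" "k \<ge> 1"
  shows "(\<Sum>d\<in>D. 1 / real d ^ (k + 1)) \<le> 2 / z ^ k"
proof -
  define M where "M = nat \<lfloor>z\<rfloor>"
  have M: "M \<ge> 1" "real M \<le> z" "z < real M + 1" using assms(2) unfolding M_def by linarith+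
  have Md: "M < d" if "d \<in> D" for d using assms(3)[OF that] M by linarith
  \<comment> \<open>Only the squares are telescoped; the remaining factor \<open>d ^ (k - 1)\<close>
    is estimated from below by \<open>z ^ (k - 1)\<close> afterwards.\<close>
  have tel: "(\<Sum>d\<in>{M<..L}. 1 / real d ^ 2) \<le> 1 / real M - 1 / real L" if "L \<ge> M" for L
    using that
  proof (induction L rule: dec_induct)
    case (step L)
    have "1 / real (Suc L) ^ 2 \<le> 1 / real L - 1 / real (Suc L)"
    proof -
      have "1 / real (Suc L) ^ 2 \<le> 1 / (real L * real (Suc L))"
        using step M unfolding power2_eq_square by (intro divide_left_mono mult_right_mono) auto
      also have "\<dots> = 1 / real L - 1 / real (Suc L)"
        using step M by (simp add: field_simps)
      finally show ?thesis .
    qed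
    moreover have "{M<..Suc L} = insert (Suc L) {M<..L}" using step by auto
    ultimately show ?case using step by simp
  qed simp
  define L where "L = Max (insert M D)"
  have "(\<Sum>d\<in>D. 1 / real d ^ 2) \<le> (\<Sum>d\<in>{M<..L}. 1 / real d ^ 2)"
    using assms(1) Md by (intro sum_mono2) (auto simp: L_def)
  also have "\<dots> \<le> 1 / real M" 
  proof -
    have "M \<le> L" using assms(1) by (simp add: L_def)
    moreover have "1 / real L \<ge> 0" by simp
    ultimately show ?thesis using tel[of L] by linarith
  qed
  \<comment> \<open>\<open>z < M + 1\<close> and \<open>M \<ge> 1\<close> give
    \<open>z \<le> 2 * M\<close>, whence the constant 2.\<close>
  also have "\<dots> \<le> 2 / z" using M by (simp add: field_simps)
  finally have sq: "(\<Sum>d\<in>D. 1 / real d ^ 2) \<le> 2 / z" .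
  have "(\<Sum>d\<in>D. 1 / real d ^ (k + 1)) \<le> (\<Sum>d\<in>D. 1 / z ^ (k - 1) * (1 / real d ^ 2))"
  proof (rule sum_mono)
    fix d assume d: "d \<in> D"
    have "real d ^ (k + 1) = real d ^ (k - 1) * real d ^ 2"
      using assms(4) by (simp flip: power_add)
    moreover have "z ^ (k - 1) \<le> real d ^ (k - 1)"
      using assms(2) assms(3)[OF d] by (intro power_mono) auto
    ultimately have "z ^ (k - 1) * real d ^ 2 \<le> real d ^ (k + 1)" by (simp add: mult_right_mono)
    moreover have "z ^ (k - 1) * real d ^ 2 > 0" using assms(2) assms(3)[OF d] by simp
    ultimately show "1 / real d ^ (k + 1) \<le> 1 / z ^ (k - 1) * (1 / real d ^ 2)"
      by (simp add: frac_le)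
  qed
  also have "\<dots> = 1 / z ^ (k - 1) * (\<Sum>d\<in>D. 1 / real d ^ 2)" by (simp add: sum_distrib_left)
  also have "\<dots> \<le> 1 / z ^ (k - 1) * (2 / z)" using sq assms(2) by (intro mult_left_mono) auto
  also have "\<dots> = 2 / z ^ k" using assms(4) by (cases k) auto
  finally show ?thesis .
qed

lemma sum_inverse_power_le_3:
  fixes D :: "nat set"
  assumes "finite D" "0 \<notin> D" "k \<ge> 1"
  shows "(\<Sum>d\<in>D. 1 / real d ^ (k + 1)) \<le> 3"
proof -
  \<comment> \<open>The term \<open>d = 1\<close> counts 1, and the others exceed 1, so the tail
    bound at \<open>z = 1\<close> gives 2 for them.\<close>
  have "(\<Sum>d\<in>D. 1 / real d ^ (k + 1)) \<le> (\<Sum>d\<in>insert 1 (D - {1}). 1 / real d ^ (k + 1))"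
    using assms by (intro sum_mono2) auto
  also have "\<dots> = 1 + (\<Sum>d\<in>D - {1}. 1 / real d ^ (k + 1))"
    using assms by (subst sum.insert) auto
  also have "(\<Sum>d\<in>D - {1}. 1 / real d ^ (k + 1)) \<le> 2 / 1 ^ k"
    using assms by (intro sum_inverse_power_tail) (auto, metis neq0_conv Suc_lessI One_nat_def)
  finally show ?thesis by simp
qed

lemma sum_inverse_le_ln:
  fixes D :: "nat set"
  assumes "finite D" "0 \<notin> D" "z \<ge> 1" "\<And>d. d \<in> D \<Longrightarrow> real d \<le> z"
  shows "(\<Sum>d\<in>D. 1 / real d) \<le> 1 + ln z"
proof -
  define M where "M = nat \<lfloor>z\<rfloor>"
  have M: "M \<ge> 1" "real M \<le> z" using assms(3) unfolding M_def by linarith+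
  have har: "(\<Sum>d\<in>{1..L}. 1 / real d) \<le> 1 + ln (real L)" if "L \<ge> 1" for L :: nat
    using that
  proof (induction L rule: dec_induct)
    case (step L)
    have "1 / real (Suc L) \<le> ln (real (Suc L)) - ln (real L)"
    proof -
      have "ln (real L / real (Suc L)) \<le> real L / real (Suc L) - 1"
        using step by (intro ln_le_minus_one) auto
      thus ?thesis using step by (simp add: ln_div field_simps)
    qed
    moreover have "{1..Suc L} = insert (Suc L) {1..L}" using step by auto
    ultimately show ?case using step by simp
  qed simp
  have "(\<Sum>d\<in>D. 1 / real d) \<le> (\<Sum>d\<in>{1..M}. 1 / real d)"
  proof (rule sum_mono2)
    show "D \<subseteq> {1..M}"
    proof
      fix d assume "d \<in> D"
      moreover from this have "d \<noteq> 0" using assms(2) by metis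
      ultimately show "d \<in> {1..M}" using assms(4)[of d] by (auto simp: M_def le_nat_floor)
    qed
  qed auto
  also have "\<dots> \<le> 1 + ln (real M)" by (rule har) fact
  also have "\<dots> \<le> 1 + ln z" using M by simp
  finally show ?thesis .
qed

text \<open>This replaces the divisor bound: primes above \<open>2 powr (1 / \<delta>)\<close> satisfy \<open>2 \<le> p powr \<delta>\<close>,
  and there are boundedly many others.\<close>

lemma two_power_card_primes_le:
  fixes \<delta> :: real
  assumes "\<delta> > 0"
  obtains C where "C \<ge> 1"
    "\<And>Q :: nat set. finite Q \<Longrightarrow> (\<And>p. p \<in> Q \<Longrightarrow> prime p) \<Longrightarrow> 2 ^ card Q \<le> C * real (\<Prod>Q) powr \<delta>"
proof
  define L where "L = nat \<lceil>2 powr (1 / \<delta>)\<rceil>"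
  show "(2::real) ^ L \<ge> 1" by simp
  fix Q :: "nat set" assume Q: "finite Q" "\<And>p. p \<in> Q \<Longrightarrow> prime p"
  have large: "2 \<le> real p powr \<delta>" if "p \<ge> L" for p
  proof -
    have "2 = (2 powr (1 / \<delta>)) powr \<delta>" using assms by (simp add: powr_powr)
    also have "\<dots> \<le> real p powr \<delta>" using that assms by (intro powr_mono2) (auto simp: L_def)
    finally show ?thesis .
  qed
  have "(2::real) ^ card Q = 2 ^ card (Q \<inter> {..<L}) * 2 ^ card (Q - {..<L})"
    using Q(1) card_Int_Diff[of Q "{..<L}"] by (simp add: power_add)
  also have "\<dots> \<le> 2 ^ L * (\<Prod>p\<in>Q. real p powr \<delta>)"
  proof (intro mult_mono)
    show "(2::real) ^ card (Q \<inter> {..<L}) \<le> 2 ^ L"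
      using card_mono[of "{..<L}" "Q \<inter> {..<L}"] by (intro power_increasing) auto
    have "(2::real) ^ card (Q - {..<L}) = (\<Prod>p\<in>Q - {..<L}. 2)" by simp
    also have "\<dots> \<le> (\<Prod>p\<in>Q - {..<L}. real p powr \<delta>)" using large by (intro prod_mono) auto
    also have "\<dots> \<le> (\<Prod>p\<in>Q. real p powr \<delta>)"
    proof (rule prod_mono2)
      fix p assume "p \<in> Q - (Q - {..<L})"
      hence "p \<ge> 1" using Q prime_ge_1_nat by auto
      thus "1 \<le> real p powr \<delta>" using assms by (simp add: ge_one_powr_ge_zero)
    qed (use Q in auto)
    finally show "(2::real) ^ card (Q - {..<L}) \<le> (\<Prod>p\<in>Q. real p powr \<delta>)" .
  qed auto
  also have "(\<Prod>p\<in>Q. real p powr \<delta>) = real (\<Prod>Q) powr \<delta>"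
    using Q(1) by (simp add: prod_powr_distrib)
  finally show "2 ^ card Q \<le> 2 ^ L * real (\<Prod>Q) powr \<delta>" .
qed

section \<open>Squarefree integers up to \<open>z\<close>, given by their prime sets\<close>

definition prime_sets :: "real \<Rightarrow> nat set set" where
  "prime_sets z = {A. finite A \<and> (\<forall>p\<in>A. prime p) \<and> real (\<Prod>A) \<le> z}"

lemma prime_setsD:
  assumes "A \<in> prime_sets z"
  shows "finite A" "\<And>p. p \<in> A \<Longrightarrow> prime p" "real (\<Prod>A) \<le> z" "\<Prod>A > 0"
    "\<And>p. p \<in> A \<Longrightarrow> real p \<le> z"
proof -
  show A: "finite A" "\<And>p. p \<in> A \<Longrightarrow> prime p" "real (\<Prod>A) \<le> z"
    using assms unfolding prime_sets_def by blast+
  show "\<Prod>A > 0" using A by (intro prod_primes_pos) auto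
  hence "p \<le> \<Prod>A" if "p \<in> A" for p
    using A that by (intro dvd_imp_le) (simp_all add: prime_dvd_prod_primes_iff)
  thus "real p \<le> z" if "p \<in> A" for p using A(3) that by (meson of_nat_mono order_trans)
qed

lemma finite_prime_sets: "finite (prime_sets z)"
proof (rule finite_subset)
  show "prime_sets z \<subseteq> Pow {..nat \<lfloor>z\<rfloor>}"
    by (auto dest: prime_setsD(5) intro: le_nat_floor)
qed auto

lemma inj_on_prod_prime_sets: "inj_on (\<lambda>A. \<Prod>A) (prime_sets z)"
  by (rule inj_on_subset[OF inj_on_prod_primes]) (auto simp: prime_sets_def)

lemma card_prime_sets_le:
  assumes "z \<ge> 0"
  shows "real (card (prime_sets z)) \<le> z"
proof -
  have "card (prime_sets z) = card ((\<lambda>A. \<Prod>A) ` prime_sets z)"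
    by (rule card_image[symmetric, OF inj_on_prod_prime_sets])
  also have "\<dots> \<le> card {1..nat \<lfloor>z\<rfloor>}"
  proof (rule card_mono)
    show "(\<lambda>A. \<Prod>A) ` prime_sets z \<subseteq> {1..nat \<lfloor>z\<rfloor>}"
    proof (rule image_subsetI)
      fix A assume A: "A \<in> prime_sets z"
      show "\<Prod>A \<in> {1..nat \<lfloor>z\<rfloor>}"
        using le_nat_floor[OF prime_setsD(3)[OF A]] prime_setsD(4)[OF A] by simp
    qed
  qed simp
  also have "real \<dots> \<le> z" using assms by simp
  finally show ?thesis by simp
qed

lemma sum_prime_sets_inverse_le:
  assumes "z \<ge> 1"
  shows "(\<Sum>A\<in>prime_sets z. 1 / real (\<Prod>A)) \<le> 1 + ln z"
proof -
  have "(\<Sum>A\<in>prime_sets z. 1 / real (\<Prod>A)) = (\<Sum>d\<in>(\<lambda>A. \<Prod>A) ` prime_sets z. 1 / real d)"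
    by (subst sum.reindex[OF inj_on_prod_prime_sets]) simp
  also have "\<dots> \<le> 1 + ln z"
  proof (rule sum_inverse_le_ln)
    show "0 \<notin> (\<lambda>A. \<Prod>A) ` prime_sets z"
      by (metis imageE less_irrefl prime_setsD(4))
    show "real d \<le> z" if "d \<in> (\<lambda>A. \<Prod>A) ` prime_sets z" for d
      using that by (metis imageE prime_setsD(3))
  qed (use assms finite_prime_sets in auto)
  finally show ?thesis .
qed

lemma sum_UN_le:
  fixes f :: "'b \<Rightarrow> real"
  assumes "finite I" "\<And>i. i \<in> I \<Longrightarrow> finite (X i)" "\<And>y. f y \<ge> 0"
  shows "(\<Sum>y\<in>(\<Union>i\<in>I. X i). f y) \<le> (\<Sum>i\<in>I. \<Sum>y\<in>X i. f y)"
  using assms(1,2)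
proof (induction I rule: finite_induct)
  case (insert i I)
  have "(\<Sum>y\<in>X i \<union> (\<Union>i\<in>I. X i). f y) \<le> (\<Sum>y\<in>X i. f y) + (\<Sum>y\<in>(\<Union>i\<in>I. X i). f y)"
    using insert assms(3) by (subst sum_Un) (auto intro!: sum_nonneg)
  also have "\<dots> \<le> (\<Sum>y\<in>X i. f y) + (\<Sum>i\<in>I. \<Sum>y\<in>X i. f y)" using insert by simp
  finally show ?case using insert by simp
qed simp

section \<open>Truncation of the Euler product\<close>

text \<open>The product expands over disjoint families of subsets of \<open>R\<close>. A family
  missing from the truncated sum has a member with product above \<open>z\<close>; the sum over that
  member is at most \<open>2 / z ^ k\<close>, and the sum over each other member is at most
  3.\<close>

lemma euler_product_tail:
  fixes S :: "'a set"
  assumes S: "finite S" and k: "k \<ge> 1" and z: "z \<ge> 1" and R: "finite R" "\<And>p. p \<in> R \<Longrightarrow> prime p"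
    and Rz: "prime_sets z \<subseteq> Pow R"
  shows "\<bar>(\<Prod>p\<in>R. 1 - real (card S) / real p ^ (k + 1)) -
     (\<Sum>A\<in>{A \<in> S \<rightarrow>\<^sub>E prime_sets z. disjoint_family_on A S}.
        \<Prod>P\<in>S. (-1) ^ card (A P) / real (\<Prod>(A P)) ^ (k + 1))\<bar>
     \<le> 2 * real (card S) * 3 ^ card S / z ^ k"
proof -
  let ?w = "\<lambda>B. (-1) ^ card B / real (\<Prod>B) ^ (k + 1)"
  let ?a = "\<lambda>B. 1 / real (\<Prod>B) ^ (k + 1)"
  let ?F = "{A \<in> S \<rightarrow>\<^sub>E Pow R. disjoint_family_on A S}"
  let ?G = "{A \<in> S \<rightarrow>\<^sub>E prime_sets z. disjoint_family_on A S}"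
  have finP: "finite (S \<rightarrow>\<^sub>E Pow R)" using S R by (intro finite_PiE) auto
  have finF: "finite ?F" by (rule finite_subset[OF _ finP]) auto
  have GF: "?G \<subseteq> ?F" using Rz by (auto simp: PiE_def Pi_def)
  have nn: "0 \<le> (\<Prod>P\<in>S. ?a (A P))" for A by (intro prod_nonneg) (simp del: of_nat_prod)
  have w: "(-1) ^ card B * (\<Prod>p\<in>B. 1 / real p ^ (k + 1)) = ?w B" for B
    by (simp add: prod_dividef prod.distrib prod_power_distrib)
  have "(\<Prod>p\<in>R. 1 - real (card S) / real p ^ (k + 1)) = (\<Prod>p\<in>R. 1 - real (card S) * (1 / real p ^ (k + 1)))"
    by simp
  also have "\<dots> = (\<Sum>A\<in>?F. \<Prod>P\<in>S. ?w (A P))"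
    by (subst prod_one_minus_card_mult[OF R(1) S]) (simp only: w)
  finally have "(\<Prod>p\<in>R. 1 - real (card S) / real p ^ (k + 1)) - (\<Sum>A\<in>?G. \<Prod>P\<in>S. ?w (A P)) =
      (\<Sum>A\<in>?F - ?G. \<Prod>P\<in>S. ?w (A P))"
    by (simp only: sum_diff[OF finF GF])
  also have "\<bar>\<dots>\<bar> \<le> (\<Sum>A\<in>?F - ?G. \<Prod>P\<in>S. ?a (A P))"
  proof (rule order_trans[OF sum_abs], rule sum_mono)
    fix A
    have "\<bar>\<Prod>P\<in>S. ?w (A P)\<bar> = (\<Prod>P\<in>S. ?a (A P))"
      unfolding abs_prod by (rule prod.cong) (simp_all del: of_nat_prod add: power_abs)
    thus "\<bar>\<Prod>P\<in>S. ?w (A P)\<bar> \<le> (\<Prod>P\<in>S. ?a (A P))" by simp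
  qed
  \<comment> \<open>The dropped families are sorted by a point \<open>P\<close> whose member is too
    large. Disjointness is given up here, so that the sums below factor over the points.\<close>
  also have "\<dots> \<le> (\<Sum>A\<in>(\<Union>P\<in>S. {A \<in> S \<rightarrow>\<^sub>E Pow R. A P \<notin> prime_sets z}). \<Prod>P\<in>S. ?a (A P))"
  proof (rule sum_mono2)
    show "finite (\<Union>P\<in>S. {A \<in> S \<rightarrow>\<^sub>E Pow R. A P \<notin> prime_sets z})"
      by (rule finite_subset[OF _ finP]) auto
    show "?F - ?G \<subseteq> (\<Union>P\<in>S. {A \<in> S \<rightarrow>\<^sub>E Pow R. A P \<notin> prime_sets z})"
      by (auto simp: PiE_def)
  qed (rule nn)
  also have "\<dots> \<le> (\<Sum>P\<in>S. \<Sum>A\<in>{A \<in> S \<rightarrow>\<^sub>E Pow R. A P \<notin> prime_sets z}. \<Prod>P\<in>S. ?a (A P))"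
    using S nn by (intro sum_UN_le finite_subset[OF _ finP]) blast+
  also have "\<dots> \<le> (\<Sum>P\<in>S. 2 / z ^ k * 3 ^ card S)"
  proof (rule sum_mono)
    fix P assume P: "P \<in> S"
    let ?B = "\<lambda>Q. if Q = P then Pow R - prime_sets z else Pow R"
    have inj: "inj_on (\<lambda>A. \<Prod>A) (Pow R)"
      using R by (intro inj_on_subset[OF inj_on_prod_primes]) (auto dest: finite_subset)
    have pos: "\<Prod>A > 0" if "A \<in> Pow R" for A using that R by (intro prod_primes_pos) auto
    have bnd: "(\<Sum>A\<in>D. ?a A) = (\<Sum>d\<in>(\<lambda>A. \<Prod>A) ` D. 1 / real d ^ (k + 1))" if "D \<subseteq> Pow R" for D
      using that inj by (subst sum.reindex) (auto intro: inj_on_subset)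
    have all: "(\<Sum>A\<in>Pow R. ?a A) \<le> 3"
      unfolding bnd[OF subset_refl]
    proof (rule sum_inverse_power_le_3)
      show "0 \<notin> (\<lambda>A. \<Prod>A) ` Pow R" using pos by (metis imageE less_irrefl)
    qed (use R(1) k in simp_all)
    have tail: "(\<Sum>A\<in>Pow R - prime_sets z. ?a A) \<le> 2 / z ^ k"
      unfolding bnd[OF Diff_subset]
    proof (rule sum_inverse_power_tail)
      fix d assume "d \<in> (\<lambda>A. \<Prod>A) ` (Pow R - prime_sets z)"
      then obtain A where A: "A \<subseteq> R" "A \<notin> prime_sets z" "d = \<Prod>A" by blast
      moreover have "finite A" using A R finite_subset by blast
      moreover have "\<forall>p\<in>A. prime p" using A R(2) by blast
      ultimately show "real d > z" by (simp add: prime_sets_def)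
    qed (use R(1) k z in simp_all)
    have "(\<Sum>A\<in>{A \<in> S \<rightarrow>\<^sub>E Pow R. A P \<notin> prime_sets z}. \<Prod>P\<in>S. ?a (A P)) =
        (\<Sum>A\<in>Pi\<^sub>E S ?B. \<Prod>P\<in>S. ?a (A P))"
      using P by (intro sum.cong refl) (auto simp: PiE_def Pi_def split: if_splits)
    also have "\<dots> = (\<Prod>Q\<in>S. \<Sum>A\<in>?B Q. ?a A)"
      using S R(1) by (intro prod_sum_PiE[symmetric]) simp_all
    also have "\<dots> = (\<Sum>A\<in>?B P. ?a A) * (\<Prod>Q\<in>S - {P}. \<Sum>A\<in>?B Q. ?a A)"
      using S P by (rule prod.remove)
    also have "\<dots> \<le> 2 / z ^ k * (\<Prod>Q\<in>S - {P}. 3)"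
    proof (intro mult_mono prod_mono)
      show "(\<Sum>A\<in>?B P. ?a A) \<le> 2 / z ^ k" using tail by simp
      fix Q assume "Q \<in> S - {P}"
      thus "0 \<le> (\<Sum>A\<in>?B Q. ?a A) \<and> (\<Sum>A\<in>?B Q. ?a A) \<le> 3" using all by (auto intro!: sum_nonneg simp del: of_nat_prod)
    qed (use z in \<open>auto intro!: prod_nonneg sum_nonneg zero_le_power simp del: of_nat_prod\<close>)
    also have "\<dots> \<le> 2 / z ^ k * 3 ^ card S"
      using z S by (intro mult_left_mono) (auto intro!: power_increasing card_mono)
    finally show "(\<Sum>A\<in>{A \<in> S \<rightarrow>\<^sub>E Pow R. A P \<notin> prime_sets z}. \<Prod>P\<in>S. ?a (A P)) \<le> 2 / z ^ k * 3 ^ card S" .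
  qed
  also have "\<dots> = 2 * real (card S) * 3 ^ card S / z ^ k" by simp
  finally show ?thesis .
qed

text \<open>The bound for finite products does not depend on \<open>R\<close>, so it passes to the
  limit along the primes up to \<open>n\<close>, which include every prime up to \<open>z\<close>
  once \<open>n\<close> is large.\<close>

lemma prodinf_primes_tail:
  fixes S :: "'a set"
  assumes S: "finite S" and k: "k \<ge> 1" and z: "z \<ge> 1"
  shows "\<bar>(\<Prod>p::nat. if prime p then 1 - real (card S) / real p ^ (k + 1) else 1) -
     (\<Sum>A\<in>{A \<in> S \<rightarrow>\<^sub>E prime_sets z. disjoint_family_on A S}.
        \<Prod>P\<in>S. (-1) ^ card (A P) / real (\<Prod>(A P)) ^ (k + 1))\<bar>
     \<le> 2 * real (card S) * 3 ^ card S / z ^ k" (is "\<bar>prodinf ?f - ?M\<bar> \<le> ?E")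
proof -
  have "summable (\<lambda>p. norm (?f p - 1))"
  proof (rule summable_comparison_test')
    show "summable (\<lambda>p. real (card S) * inverse (real p ^ (k + 1)))"
      using k by (intro summable_mult inverse_power_summable) auto
  qed (auto simp: field_simps)
  hence "abs_convergent_prod ?f" by (rule summable_imp_abs_convergent_prod)
  hence "convergent_prod ?f" by (rule abs_convergent_prod_imp_convergent_prod)
  hence "(\<lambda>n. \<Prod>p\<le>n. ?f p) \<longlonglongrightarrow> prodinf ?f" by (rule convergent_prod_LIMSEQ)
  hence lim: "(\<lambda>n. \<bar>(\<Prod>p\<le>n. ?f p) - ?M\<bar>) \<longlonglongrightarrow> \<bar>prodinf ?f - ?M\<bar>"
    by (intro tendsto_intros)
  have "\<bar>(\<Prod>p\<le>n. ?f p) - ?M\<bar> \<le> ?E" if n: "n \<ge> nat \<lfloor>z\<rfloor>" for n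
  proof -
    let ?R = "{p. p \<le> n \<and> prime p}"
    have eq: "(\<Prod>p\<le>n. ?f p) = (\<Prod>p\<in>?R. 1 - real (card S) / real p ^ (k + 1))"
      by (intro prod.mono_neutral_cong_right) auto
    have "prime_sets z \<subseteq> Pow ?R"
      using n by (auto dest: prime_setsD(2) prime_setsD(5) intro: order_trans[OF le_nat_floor])
    thus ?thesis
      unfolding eq by (intro euler_product_tail[OF S k z]) auto
  qed
  thus ?thesis by (intro LIMSEQ_le_const2[OF lim]) blast
qed

section \<open>Counting visible points\<close>

text \<open>The interval count \<open>x / d + 1\<close> is absorbed into \<open>3 * x / d\<close>
  while \<open>d \<le> 2 * x\<close>. For larger \<open>d\<close> the condition
  \<open>m \<noteq> u\<close> leaves no solution, since \<open>m - u\<close> has size at most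
  \<open>2 * x\<close>. Having no additive constant is what permits summation over many
  \<open>d\<close>.\<close>

lemma card_nonzero_multiples_le:
  fixes d u :: int and x :: real
  assumes "d > 0" "x \<ge> 0" "\<bar>of_int u\<bar> \<le> x"
  shows "real (card {m. 1 \<le> m \<and> of_int m \<le> x \<and> m \<noteq> u \<and> d dvd m - u}) \<le> 3 * x / of_int d"
proof (cases "of_int d \<le> 2 * x")
  case True
  have "card {m. 1 \<le> m \<and> of_int m \<le> x \<and> m \<noteq> u \<and> d dvd m - u} \<le>
      card {m. 1 \<le> m \<and> of_int m \<le> x \<and> d dvd m - u}"
    using card_residue_class_interval(1)[OF assms(1,2)] by (intro card_mono) auto
  also have "real \<dots> \<le> x / of_int d + 1"
    using card_residue_class_interval(2)[OF assms(1,2), of u] by linarith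
  also have "\<dots> \<le> 3 * x / of_int d" using True assms by (simp add: field_simps)
  finally show ?thesis by simp
next
  case False
  have "\<not> (1 \<le> m \<and> of_int m \<le> x \<and> m \<noteq> u \<and> d dvd m - u)" for m
  proof
    assume m: "1 \<le> m \<and> of_int m \<le> x \<and> m \<noteq> u \<and> d dvd m - u"
    hence "\<bar>d\<bar> \<le> \<bar>m - u\<bar>" by (intro dvd_imp_le_int) auto
    hence "d \<le> \<bar>m - u\<bar>" using assms(1) by linarith
    hence "real_of_int d \<le> \<bar>of_int m - of_int u\<bar>" by linarith
    moreover have "(1::real) \<le> of_int m" using m by simp
    ultimately show False using m False assms by linarith
  qed
  hence empty: "{m. 1 \<le> m \<and> of_int m \<le> x \<and> m \<noteq> u \<and> d dvd m - u} = {}" by blast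
  show ?thesis unfolding empty using assms by simp
qed

definition blocking_primes :: "nat \<Rightarrow> int \<times> int \<Rightarrow> int \<times> int \<Rightarrow> nat set" where
  "blocking_primes k P Q =
     {p. prime p \<and> int p dvd fst Q - fst P \<and> int p ^ k dvd snd Q - snd P}"

lemma k_visible_iff_blocking_primes:
  "k_visible k Q P \<longleftrightarrow> fst Q \<noteq> fst P \<and> blocking_primes k P Q = {}"
  using k_visible_iff[of k "fst Q" "snd Q" "fst P" "snd P"] by (auto simp: blocking_primes_def)

text \<open>\<open>x\<close> is fixed together with \<open>S\<close> because \<open>bounded\<close>
  ties them together: coordinate differences are then at most \<open>2 * x\<close>, which keeps the
  constants independent of the positions of the points.\<close>

locale visible_family =
  fixes k :: nat and S :: "(int \<times> int) set" and x :: real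
  assumes k: "k \<ge> 2" and finS: "finite S" and pw: "pairwise (k_visible k) S" and x: "x \<ge> 2"
    and bounded: "\<And>P. P \<in> S \<Longrightarrow> \<bar>of_int (fst P)\<bar> \<le> x \<and> \<bar>of_int (snd P)\<bar> \<le> x"
begin

text \<open>Points on the lines \<open>n = v\<close> are set aside (at most \<open>N x\<close> of them): there \<open>p ^ k dvd n - v\<close>
  gives no bound on \<open>p\<close>.\<close>

definition generic_points :: "(int \<times> int) set" where
  "generic_points = {Q. 1 \<le> fst Q \<and> of_int (fst Q) \<le> x \<and> 1 \<le> snd Q \<and> of_int (snd Q) \<le> x \<and>
     (\<forall>P\<in>S. fst Q \<noteq> fst P \<and> snd Q \<noteq> snd P)}"

definition full_sum :: "int \<times> int \<Rightarrow> int \<times> int \<Rightarrow> real" where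
  "full_sum P Q = (\<Sum>A\<in>Pow (blocking_primes k P Q). (-1) ^ card A)"

text \<open>The sum runs over an index set that does not involve \<open>P\<close> or
  \<open>Q\<close>, so that the product over \<open>S\<close> can be expanded and the sum over
  \<open>Q\<close> moved inside.\<close>

definition truncated_sum :: "real \<Rightarrow> int \<times> int \<Rightarrow> int \<times> int \<Rightarrow> real" where
  "truncated_sum z P Q = (\<Sum>A\<in>prime_sets z. if A \<subseteq> blocking_primes k P Q then (-1) ^ card A else 0)"

lemma finite_generic_points: "finite generic_points"
proof (rule finite_subset)
  show "generic_points \<subseteq> {1..\<lfloor>x\<rfloor>} \<times> {1..\<lfloor>x\<rfloor>}"
    by (auto simp: generic_points_def le_floor_iff)
qed auto

lemma generic_pointsD:
  assumes "Q \<in> generic_points" "P \<in> S"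
  shows "fst Q \<noteq> fst P" "snd Q \<noteq> snd P"
    "\<bar>real_of_int (fst Q - fst P)\<bar> \<le> 2 * x" "\<bar>real_of_int (snd Q - snd P)\<bar> \<le> 2 * x"
proof -
  show "fst Q \<noteq> fst P" "snd Q \<noteq> snd P" using assms by (auto simp: generic_points_def)
  have "(1::real) \<le> of_int (fst Q)" "(1::real) \<le> of_int (snd Q)"
    "of_int (fst Q) \<le> x" "of_int (snd Q) \<le> x"
    using assms by (auto simp: generic_points_def)
  thus "\<bar>real_of_int (fst Q - fst P)\<bar> \<le> 2 * x" "\<bar>real_of_int (snd Q - snd P)\<bar> \<le> 2 * x"
    using bounded[OF assms(2)] by auto
qed

lemma finite_blocking_primes:
  assumes "Q \<in> generic_points" "P \<in> S"
  shows "finite (blocking_primes k P Q)"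
proof (rule finite_subset)
  show "blocking_primes k P Q \<subseteq> {p. p dvd nat \<bar>fst Q - fst P\<bar>}"
    by (auto simp: blocking_primes_def nat_dvd_iff)
  show "finite {p. p dvd nat \<bar>fst Q - fst P\<bar>}"
    using generic_pointsD(1)[OF assms] by (intro finite_divisors_nat) auto
qed

lemma prime_blocking_primes: "p \<in> blocking_primes k P Q \<Longrightarrow> prime p"
  by (simp add: blocking_primes_def)

lemma prod_blocking_primes_dvd:
  assumes "Q \<in> generic_points" "P \<in> S"
  shows "int (\<Prod>(blocking_primes k P Q)) dvd fst Q - fst P"
    and "int (\<Prod>(blocking_primes k P Q)) ^ k dvd snd Q - snd P"
proof -
  have *: "int (\<Prod>(blocking_primes k P Q)) ^ j dvd n \<longleftrightarrow> (\<forall>p\<in>blocking_primes k P Q. int p ^ j dvd n)" for j n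
    by (intro prod_primes_power_dvd_iff finite_blocking_primes[OF assms] prime_blocking_primes)
  show "int (\<Prod>(blocking_primes k P Q)) dvd fst Q - fst P"
    using *[of 1 "fst Q - fst P"] by (simp del: of_nat_prod add: blocking_primes_def)
  show "int (\<Prod>(blocking_primes k P Q)) ^ k dvd snd Q - snd P"
    unfolding * by (simp add: blocking_primes_def)
qed

text \<open>A divisor of a nonzero integer is at most its absolute value. For the second bound
  \<open>Q\<close> has to lie off the horizontal line through \<open>P\<close>.\<close>

lemma prod_blocking_primes_le:
  assumes "Q \<in> generic_points" "P \<in> S"
  shows "real (\<Prod>(blocking_primes k P Q)) \<le> 2 * x"
    and "real (\<Prod>(blocking_primes k P Q)) ^ k \<le> 2 * x"
proof -
  let ?d = "\<Prod>(blocking_primes k P Q)"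
  have "int ?d \<le> \<bar>fst Q - fst P\<bar>"
    using dvd_imp_le_int[OF _ prod_blocking_primes_dvd(1)[OF assms]] generic_pointsD(1)[OF assms] by simp
  hence "real_of_int (int ?d) \<le> \<bar>real_of_int (fst Q - fst P)\<bar>" by linarith
  thus "real ?d \<le> 2 * x" using generic_pointsD(3)[OF assms] by simp
  have "\<bar>int ?d ^ k\<bar> \<le> \<bar>snd Q - snd P\<bar>"
    using dvd_imp_le_int[OF _ prod_blocking_primes_dvd(2)[OF assms]] generic_pointsD(2)[OF assms] by simp
  hence "real_of_int (int ?d ^ k) \<le> \<bar>real_of_int (snd Q - snd P)\<bar>" by linarith
  thus "real ?d ^ k \<le> 2 * x" using generic_pointsD(4)[OF assms] by simp
qed

lemma prod_full_sum:
  assumes "Q \<in> generic_points"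
  shows "(\<Prod>P\<in>S. full_sum P Q) = (if \<forall>P\<in>S. k_visible k Q P then 1 else 0)"
proof -
  have "full_sum P Q = (if k_visible k Q P then 1 else 0)" if "P \<in> S" for P
    unfolding full_sum_def
    using sum_Pow_alternating[OF finite_blocking_primes[OF assms that]] generic_pointsD[OF assms that] k
    by (simp add: k_visible_iff_blocking_primes)
  hence "(\<Prod>P\<in>S. full_sum P Q) = (\<Prod>P\<in>S. if k_visible k Q P then 1 else 0)" by simp
  also have "\<dots> = (if \<forall>P\<in>S. k_visible k Q P then 1 else 0)"
    using finS by (auto simp: prod_zero_iff)
  finally show ?thesis .
qed

text \<open>A visible point never shares its abscissa with a point of \<open>S\<close>. Hence the
  visible points that are not generic lie on the horizontal lines through \<open>S\<close>, each of
  which holds at most \<open>x\<close> of them.\<close>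

lemma visible_count_approx:
  "\<bar>real (visible_count k S x) - (\<Sum>Q\<in>generic_points. \<Prod>P\<in>S. full_sum P Q)\<bar> \<le> real (card S) * x"
proof -
  define V where "V = {(m, n). (m, n) \<in> visible_set k S \<and> of_int m \<le> x \<and> of_int n \<le> x}"
  have finV: "finite V"
    by (rule finite_subset[of _ "{1..\<lfloor>x\<rfloor>} \<times> {1..\<lfloor>x\<rfloor>}"]) (auto simp: V_def visible_set_def le_floor_iff)
  have VI: "V \<inter> generic_points = {Q \<in> generic_points. \<forall>P\<in>S. k_visible k Q P}"
    by (auto simp: V_def visible_set_def generic_points_def)
  have "(\<Sum>Q\<in>generic_points. \<Prod>P\<in>S. full_sum P Q) =
      (\<Sum>Q\<in>generic_points. if \<forall>P\<in>S. k_visible k Q P then 1 else 0)"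
    by (intro sum.cong refl prod_full_sum)
  also have "\<dots> = real (card (V \<inter> generic_points))"
    unfolding VI using finite_generic_points by (simp add: sum.If_cases Int_def)
  finally have eq: "(\<Sum>Q\<in>generic_points. \<Prod>P\<in>S. full_sum P Q) = real (card (V \<inter> generic_points))" .
  have "V - generic_points \<subseteq> (\<Union>P\<in>S. {1..\<lfloor>x\<rfloor>} \<times> {snd P})"
  proof
    fix Q assume Q: "Q \<in> V - generic_points"
    obtain m n where mn: "Q = (m, n)" by (cases Q)
    have *: "1 \<le> m" "1 \<le> n" "of_int m \<le> x" "of_int n \<le> x" "\<forall>P\<in>S. k_visible k (m, n) P"
      using Q by (auto simp: V_def visible_set_def mn)
    hence "\<forall>P\<in>S. m \<noteq> fst P" using k by (auto simp: k_visible_def)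
    with * Q obtain P where "P \<in> S" "n = snd P" by (auto simp: generic_points_def mn)
    thus "Q \<in> (\<Union>P\<in>S. {1..\<lfloor>x\<rfloor>} \<times> {snd P})" using * mn by (auto simp: le_floor_iff)
  qed
  hence "card (V - generic_points) \<le> card (\<Union>P\<in>S. {1..\<lfloor>x\<rfloor>} \<times> {snd P})"
    using finS by (intro card_mono) auto
  also have "\<dots> \<le> (\<Sum>P\<in>S. card ({1..\<lfloor>x\<rfloor>} \<times> {snd P}))" using finS by (rule card_UN_le)
  also have "real \<dots> = real (card S) * real (nat \<lfloor>x\<rfloor>)" by (simp add: card_cartesian_product)
  also have "\<dots> \<le> real (card S) * x" using x by (intro mult_left_mono) linarith+
  finally have le: "real (card (V - generic_points)) \<le> real (card S) * x" by simp
  have "card V = card (V \<inter> generic_points) + card (V - generic_points)"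
    using finV by (metis card_Int_Diff)
  moreover have "visible_count k S x = card V" by (simp add: visible_count_def V_def)
  ultimately show ?thesis using le eq by simp
qed

text \<open>If all blocking products are at most \<open>z\<close>, truncation changes nothing.
  Otherwise the full product is 0 or 1, each truncated sum has at most \<open>B\<close> terms of
  absolute value 1, and the cost is charged to a point whose blocking product exceeds
  \<open>z\<close>.\<close>

lemma truncation_error:
  assumes Q: "Q \<in> generic_points" and B: "B \<ge> 1" "\<And>P. P \<in> S \<Longrightarrow> 2 ^ card (blocking_primes k P Q) \<le> B"
  shows "\<bar>(\<Prod>P\<in>S. full_sum P Q) - (\<Prod>P\<in>S. truncated_sum z P Q)\<bar>
    \<le> (\<Sum>P\<in>S. if real (\<Prod>(blocking_primes k P Q)) > z then 1 + B ^ card S else 0)"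
proof -
  let ?b = "\<lambda>P. blocking_primes k P Q"
  have tr: "truncated_sum z P Q = (\<Sum>A\<in>prime_sets z \<inter> Pow (?b P). (-1) ^ card A)" for P
    unfolding truncated_sum_def using finite_prime_sets
    by (intro sum.mono_neutral_cong_right) auto
  show ?thesis
  proof (cases "\<forall>P\<in>S. real (\<Prod>(?b P)) \<le> z")
    case True
    have "truncated_sum z P Q = full_sum P Q" if P: "P \<in> S" for P
    proof -
      \<comment> \<open>The product of a subset divides the whole blocking product, so it is at most
        \<open>z\<close> as well.\<close>
      have "Pow (?b P) \<subseteq> prime_sets z"
      proof
        fix A assume A: "A \<in> Pow (?b P)"
        hence "\<Prod>A dvd \<Prod>(?b P)"
          using finite_blocking_primes[OF Q P] by (intro prod_dvd_prod_subset) auto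
        moreover have "\<Prod>(?b P) > 0" by (intro prod_primes_pos prime_blocking_primes)
        ultimately have "\<Prod>A \<le> \<Prod>(?b P)" by (rule dvd_imp_le)
        hence "real (\<Prod>A) \<le> real (\<Prod>(?b P))" by (rule of_nat_mono)
        also have "\<dots> \<le> z" using True P by blast
        finally show "A \<in> prime_sets z"
          using A finite_blocking_primes[OF Q P] finite_subset[of A] prime_blocking_primes
          unfolding prime_sets_def by blast
      qed
      hence "prime_sets z \<inter> Pow (?b P) = Pow (?b P)" by blast
      thus ?thesis by (simp add: tr full_sum_def)
    qed
    hence "(\<Prod>P\<in>S. truncated_sum z P Q) = (\<Prod>P\<in>S. full_sum P Q)" by simp
    moreover have "0 \<le> (\<Sum>P\<in>S. if real (\<Prod>(?b P)) > z then 1 + B ^ card S else 0)"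
      using B(1) by (intro sum_nonneg) auto
    ultimately show ?thesis by simp
  next
    case False
    then obtain P where P: "P \<in> S" "real (\<Prod>(?b P)) > z" by force
    have "\<bar>truncated_sum z R Q\<bar> \<le> B" if "R \<in> S" for R
    proof -
      have "\<bar>truncated_sum z R Q\<bar> \<le> (\<Sum>A\<in>prime_sets z \<inter> Pow (?b R). \<bar>(-1) ^ card A\<bar>)"
        unfolding tr by (rule sum_abs)
      also have "\<dots> = real (card (prime_sets z \<inter> Pow (?b R)))" by (simp add: power_abs)
      also have "card (prime_sets z \<inter> Pow (?b R)) \<le> card (Pow (?b R))"
        using finite_blocking_primes[OF Q that] by (intro card_mono) auto
      also have "real \<dots> = 2 ^ card (?b R)"
        using finite_blocking_primes[OF Q that] by (simp add: card_Pow)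
      also have "\<dots> \<le> B" using B(2) that .
      finally show ?thesis by simp
    qed
    hence "\<bar>\<Prod>P\<in>S. truncated_sum z P Q\<bar> \<le> (\<Prod>P\<in>S. B)"
      unfolding abs_prod by (intro prod_mono) auto
    hence "\<bar>\<Prod>P\<in>S. truncated_sum z P Q\<bar> \<le> B ^ card S" by simp
    moreover have "\<bar>\<Prod>P\<in>S. full_sum P Q\<bar> \<le> 1" by (simp add: prod_full_sum[OF Q])
    ultimately have "\<bar>(\<Prod>P\<in>S. full_sum P Q) - (\<Prod>P\<in>S. truncated_sum z P Q)\<bar> \<le> 1 + B ^ card S"
      by linarith
    also have "\<dots> = (if real (\<Prod>(?b P)) > z then 1 + B ^ card S else 0)" using P by simp
    also have "\<dots> \<le> (\<Sum>P\<in>S. if real (\<Prod>(?b P)) > z then 1 + B ^ card S else 0)"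
      using finS P B(1) by (intro member_le_sum) auto
    finally show ?thesis .
  qed
qed

text \<open>Such a point solves the two congruences modulo \<open>d\<close> and
  \<open>d ^ k\<close>, where \<open>d\<close> is its blocking product. For each \<open>d\<close>
  there are at most \<open>(3 * x / d) * (3 * x / d ^ k)\<close> solutions, and the sum over
  \<open>d > z\<close> is a tail of the series of \<open>1 / d ^ (k + 1)\<close>.\<close>

lemma card_large_blocking_le:
  assumes P: "P \<in> S" and z: "z \<ge> 1"
  shows "real (card {Q \<in> generic_points. real (\<Prod>(blocking_primes k P Q)) > z}) \<le> 18 * x\<^sup>2 / z ^ k"
proof -
  let ?D = "{d::nat. z < real d \<and> real d \<le> 2 * x}"
  let ?X = "\<lambda>d. {m. 1 \<le> m \<and> of_int m \<le> x \<and> m \<noteq> fst P \<and> int d dvd m - fst P}"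
  let ?Y = "\<lambda>d. {n. 1 \<le> n \<and> of_int n \<le> x \<and> n \<noteq> snd P \<and> int d ^ k dvd n - snd P}"
  have finD: "finite ?D"
    by (rule finite_subset[of _ "{..nat \<lfloor>2 * x\<rfloor>}"]) (auto simp: le_nat_floor)
  have fin1: "finite {m. 1 \<le> m \<and> of_int m \<le> x \<and> R m}" for R
    by (rule finite_subset[of _ "{1..\<lfloor>x\<rfloor>}"]) (auto simp: le_floor_iff)
  have "{Q \<in> generic_points. real (\<Prod>(blocking_primes k P Q)) > z} \<subseteq> (\<Union>d\<in>?D. ?X d \<times> ?Y d)"
  proof
    fix Q assume "Q \<in> {Q \<in> generic_points. real (\<Prod>(blocking_primes k P Q)) > z}"
    hence Q: "Q \<in> generic_points" and gt: "real (\<Prod>(blocking_primes k P Q)) > z" by auto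
    have "\<Prod>(blocking_primes k P Q) \<in> ?D" using gt prod_blocking_primes_le(1)[OF Q P] by simp
    moreover have "Q \<in> ?X (\<Prod>(blocking_primes k P Q)) \<times> ?Y (\<Prod>(blocking_primes k P Q))"
      using prod_blocking_primes_dvd[OF Q P] Q P by (auto simp: generic_points_def mem_Times_iff)
    ultimately show "Q \<in> (\<Union>d\<in>?D. ?X d \<times> ?Y d)" by blast
  qed
  hence "card {Q \<in> generic_points. real (\<Prod>(blocking_primes k P Q)) > z} \<le> card (\<Union>d\<in>?D. ?X d \<times> ?Y d)"
    by (intro card_mono finite_UN_I finite_cartesian_product finD fin1)
  also have "\<dots> \<le> (\<Sum>d\<in>?D. card (?X d \<times> ?Y d))" using finD by (rule card_UN_le)
  also have "real \<dots> = (\<Sum>d\<in>?D. real (card (?X d)) * real (card (?Y d)))"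
    by (simp add: card_cartesian_product)
  also have "\<dots> \<le> (\<Sum>d\<in>?D. (3 * x / real d) * (3 * x / real d ^ k))"
  proof (intro sum_mono mult_mono)
    fix d assume "d \<in> ?D"
    hence d: "d > 0" using z by (auto intro!: Nat.gr0I)
    show "real (card (?X d)) \<le> 3 * x / real d"
      using card_nonzero_multiples_le[of "int d" x "fst P"] d x bounded[OF P] by simp
    show "real (card (?Y d)) \<le> 3 * x / real d ^ k"
      using card_nonzero_multiples_le[of "int d ^ k" x "snd P"] d x bounded[OF P] by simp
  qed (use x in auto)
  also have "\<dots> = 9 * x\<^sup>2 * (\<Sum>d\<in>?D. 1 / real d ^ (k + 1))"
    by (simp add: sum_distrib_left power2_eq_square)
  also have "\<dots> \<le> 9 * x\<^sup>2 * (2 / z ^ k)"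
    using finD z k by (intro mult_left_mono sum_inverse_power_tail) auto
  finally show ?thesis by simp
qed

lemma no_large_blocking:
  assumes "P \<in> S" "z \<ge> 1" "z ^ k \<ge> 2 * x" "Q \<in> generic_points"
  shows "\<not> real (\<Prod>(blocking_primes k P Q)) > z"
proof
  assume "real (\<Prod>(blocking_primes k P Q)) > z"
  hence "real (\<Prod>(blocking_primes k P Q)) ^ k > z ^ k"
    using assms k by (intro power_strict_mono) auto
  thus False using prod_blocking_primes_le(2)[OF assms(4,1)] assms(3) by linarith
qed

section \<open>Simultaneous congruences for all points of \<open>S\<close>\<close>

definition solution_count :: "(int \<times> int \<Rightarrow> nat set) \<Rightarrow> nat" where
  "solution_count A = card {Q \<in> generic_points. \<forall>P\<in>S. A P \<subseteq> blocking_primes k P Q}"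

lemma sum_prod_truncated_sum:
  "(\<Sum>Q\<in>generic_points. \<Prod>P\<in>S. truncated_sum z P Q) =
   (\<Sum>A\<in>S \<rightarrow>\<^sub>E prime_sets z. (\<Prod>P\<in>S. (-1) ^ card (A P)) * real (solution_count A))"
proof -
  have "(\<Prod>P\<in>S. truncated_sum z P Q) =
      (\<Sum>A\<in>S \<rightarrow>\<^sub>E prime_sets z. (\<Prod>P\<in>S. (-1) ^ card (A P)) *
         (if \<forall>P\<in>S. A P \<subseteq> blocking_primes k P Q then 1 else 0))" for Q
  proof -
    have "(\<Prod>P\<in>S. truncated_sum z P Q) = (\<Sum>A\<in>S \<rightarrow>\<^sub>E prime_sets z. \<Prod>P\<in>S.
        if A P \<subseteq> blocking_primes k P Q then (-1) ^ card (A P) else 0)"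
      unfolding truncated_sum_def by (rule prod_sum_PiE) (use finS finite_prime_sets in auto)
    also have "\<dots> = (\<Sum>A\<in>S \<rightarrow>\<^sub>E prime_sets z. (\<Prod>P\<in>S. (-1) ^ card (A P)) *
         (if \<forall>P\<in>S. A P \<subseteq> blocking_primes k P Q then 1 else 0))"
      using finS by (intro sum.cong refl) (auto intro!: prod.cong prod_zero)
    finally show ?thesis .
  qed
  hence "(\<Sum>Q\<in>generic_points. \<Prod>P\<in>S. truncated_sum z P Q) =
    (\<Sum>A\<in>S \<rightarrow>\<^sub>E prime_sets z. \<Sum>Q\<in>generic_points. (\<Prod>P\<in>S. (-1) ^ card (A P)) *
         (if \<forall>P\<in>S. A P \<subseteq> blocking_primes k P Q then 1 else 0))"
    by (simp only:) (rule sum.swap)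
  also have "\<dots> = (\<Sum>A\<in>S \<rightarrow>\<^sub>E prime_sets z. (\<Prod>P\<in>S. (-1) ^ card (A P)) * real (solution_count A))"
    unfolding solution_count_def using finite_generic_points
    by (intro sum.cong refl) (simp add: sum.If_cases Int_def flip: sum_distrib_left)
  finally show ?thesis .
qed

text \<open>A prime assigned to both \<open>P\<close> and \<open>R\<close> would, by subtracting the
  congruences at \<open>Q\<close>, block \<open>P\<close> from \<open>R\<close>. This is where
  pairwise visibility enters.\<close>

lemma solution_count_not_disjoint:
  assumes "\<not> disjoint_family_on A S"
  shows "solution_count A = 0"
proof -
  obtain P R p where PR: "P \<in> S" "R \<in> S" "P \<noteq> R" "p \<in> A P" "p \<in> A R"
    using assms unfolding disjoint_family_on_def by blast
  have "{Q \<in> generic_points. \<forall>P\<in>S. A P \<subseteq> blocking_primes k P Q} = {}"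
  proof (rule ccontr)
    assume "{Q \<in> generic_points. \<forall>P\<in>S. A P \<subseteq> blocking_primes k P Q} \<noteq> {}"
    then obtain Q where "p \<in> blocking_primes k P Q" "p \<in> blocking_primes k R Q"
      using PR by blast
    hence p: "prime p" "int p dvd fst Q - fst P" "int p dvd fst Q - fst R"
       "int p ^ k dvd snd Q - snd P" "int p ^ k dvd snd Q - snd R"
      by (auto simp: blocking_primes_def)
    have "int p dvd fst P - fst R" using dvd_diff[OF p(3,2)] by simp
    moreover have "int p ^ k dvd snd P - snd R" using dvd_diff[OF p(5,4)] by simp
    ultimately have "p \<in> blocking_primes k R P" using p by (simp add: blocking_primes_def)
    moreover have "k_visible k P R" using pw PR by (auto simp: pairwise_def)
    ultimately show False using k by (simp add: k_visible_iff_blocking_primes)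
  qed
  thus ?thesis unfolding solution_count_def by (simp only: card.empty)
qed

text \<open>Disjointness makes the moduli coprime, so the solutions in the square form a box of one
  residue class modulo \<open>d\<close> times one modulo \<open>d ^ k\<close>. The sides are
  \<open>x / d\<close> and \<open>x / d ^ k\<close> up to 1; what remains is to remove the lines
  through \<open>S\<close>.\<close>

lemma solution_count_disjoint:
  assumes A: "A \<in> S \<rightarrow>\<^sub>E prime_sets z" and disj: "disjoint_family_on A S"
  defines "d \<equiv> \<Prod>P\<in>S. \<Prod>(A P)"
  shows "\<bar>real (solution_count A) - x\<^sup>2 / real d ^ (k + 1)\<bar> \<le> (2 * real (card S) + 1) * (2 * x / real d + 1)"
proof -
  have AP: "A P \<in> prime_sets z" if "P \<in> S" for P using A that by auto
  have d0: "d > 0" unfolding d_def by (rule prod_pos) (rule prime_setsD(4)[OF AP])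
  have cop: "coprime (int (\<Prod>(A P)) ^ j) (int (\<Prod>(A R)) ^ j)" if "P \<in> S" "R \<in> S" "P \<noteq> R" for P R j
  proof -
    have "coprime (\<Prod>(A P)) (\<Prod>(A R))"
    proof (intro prod_coprime_left prod_coprime_right)
      fix p q assume "p \<in> A P" "q \<in> A R"
      moreover from this have "p \<noteq> q" using disj that unfolding disjoint_family_on_def by blast
      ultimately show "coprime p q"
        using prime_setsD(2)[OF AP[OF that(1)]] prime_setsD(2)[OF AP[OF that(2)]] by (intro primes_coprime)
    qed
    thus ?thesis by (simp del: of_nat_prod)
  qed
  \<comment> \<open>The exponent \<open>j\<close> is 1 for abscissas and \<open>k\<close> for
    ordinates.\<close>
  have crt: "\<exists>a. \<forall>n. (\<forall>P\<in>S. \<forall>p\<in>A P. int p ^ j dvd n - f P) \<longleftrightarrow> int d ^ j dvd n - a" for j and f :: "int \<times> int \<Rightarrow> int"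
  proof -
    have "(\<forall>P\<in>S. \<forall>p\<in>A P. int p ^ j dvd n - f P) \<longleftrightarrow> (\<forall>P\<in>S. int (\<Prod>(A P)) ^ j dvd n - f P)" for n
      by (intro ball_cong refl prod_primes_power_dvd_iff[symmetric] prime_setsD(1,2)[OF AP])
    moreover have "(\<Prod>P\<in>S. int (\<Prod>(A P)) ^ j) = int d ^ j"
      unfolding d_def by (simp add: prod_power_distrib)
    moreover have "\<exists>a. \<forall>n. (\<forall>P\<in>S. int (\<Prod>(A P)) ^ j dvd n - f P) \<longleftrightarrow> (\<Prod>P\<in>S. int (\<Prod>(A P)) ^ j) dvd n - a"
      by (rule chinese_remainder_int_ex[OF finS cop])
    ultimately show ?thesis by (simp only:)
  qed
  obtain a where a: "\<And>m. (\<forall>P\<in>S. \<forall>p\<in>A P. int p dvd m - fst P) \<longleftrightarrow> int d dvd m - a"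
    using crt[of 1 fst] by auto
  obtain b where b: "\<And>n. (\<forall>P\<in>S. \<forall>p\<in>A P. int p ^ k dvd n - snd P) \<longleftrightarrow> int d ^ k dvd n - b"
    using crt[of k snd] by auto
  define X where "X = {m. 1 \<le> m \<and> of_int m \<le> x \<and> int d dvd m - a}"
  define Y where "Y = {n. 1 \<le> n \<and> of_int n \<le> x \<and> int d ^ k dvd n - b}"
  have X: "finite X" "\<bar>real (card X) - x / real d\<bar> \<le> 1"
    using card_residue_class_interval[of "int d" x a] d0 x by (simp_all add: X_def)
  have Y: "finite Y" "\<bar>real (card Y) - x / real d ^ k\<bar> \<le> 1"
    using card_residue_class_interval[of "int d ^ k" x b] d0 x by (simp_all add: Y_def)
  \<comment> \<open>Genericity deletes at most \<open>card S\<close> columns and at most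
    \<open>card S\<close> rows of the box.\<close>
  have sol: "{Q \<in> generic_points. \<forall>P\<in>S. A P \<subseteq> blocking_primes k P Q} =
      X \<times> Y - ((fst ` S) \<times> Y \<union> X \<times> (snd ` S))" (is "?L = ?R")
  proof (rule set_eqI)
    fix Q :: "int \<times> int"
    obtain m n where mn: "Q = (m, n)" by (cases Q)
    have "(\<forall>P\<in>S. A P \<subseteq> blocking_primes k P Q) \<longleftrightarrow>
      (\<forall>P\<in>S. \<forall>p\<in>A P. int p dvd m - fst P) \<and> (\<forall>P\<in>S. \<forall>p\<in>A P. int p ^ k dvd n - snd P)"
      using prime_setsD(2)[OF AP] unfolding blocking_primes_def mn by auto
    thus "Q \<in> ?L \<longleftrightarrow> Q \<in> ?R"
      unfolding a b by (auto simp: mn X_def Y_def generic_points_def)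
  qed
  have "card (X \<times> Y) \<le> card ?R + card ((fst ` S) \<times> Y \<union> X \<times> (snd ` S))"
  proof (rule order_trans[OF card_mono card_Un_le])
    show "finite (?R \<union> ((fst ` S) \<times> Y \<union> X \<times> (snd ` S)))" using X Y finS by simp
  qed blast
  moreover have "card ((fst ` S) \<times> Y \<union> X \<times> (snd ` S)) \<le> card S * card Y + card X * card S"
  proof (rule order_trans[OF card_Un_le], rule add_mono)
    show "card ((fst ` S) \<times> Y) \<le> card S * card Y"
      using card_image_le[OF finS, of fst] by (simp add: card_cartesian_product)
    show "card (X \<times> (snd ` S)) \<le> card X * card S"
      using card_image_le[OF finS, of snd] by (simp add: card_cartesian_product)
  qed
  moreover have "card ?R \<le> card (X \<times> Y)" using X Y by (intro card_mono) auto
  ultimately have "card X * card Y \<le> solution_count A + card S * (card X + card Y)"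
    "solution_count A \<le> card X * card Y"
    by (auto simp: solution_count_def sol card_cartesian_product algebra_simps)
  hence "real (card X * card Y) \<le> real (solution_count A + card S * (card X + card Y))"
    "real (solution_count A) \<le> real (card X * card Y)" by (simp_all only: of_nat_mono)
  hence s: "\<bar>real (solution_count A) - real (card X) * real (card Y)\<bar> \<le> real (card S) * (real (card X) + real (card Y))"
    by (simp add: algebra_simps)
  \<comment> \<open>Multiplying out the two counts with their rounding errors leaves two linear
    terms, each at most \<open>x / d\<close>, and a product at most 1.\<close>
  define \<theta> where "\<theta> = real (card X) - x / real d"
  define \<theta>' where "\<theta>' = real (card Y) - x / real d ^ k"
  have th: "\<bar>\<theta>\<bar> \<le> 1" "\<bar>\<theta>'\<bar> \<le> 1" using X Y by (simp_all add: \<theta>_def \<theta>'_def)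
  have dk: "x / real d ^ k \<le> x / real d"
    using d0 x k by (intro divide_left_mono self_le_power) (auto simp: Suc_le_eq)
  have "real (card X) * real (card Y) - x\<^sup>2 / real d ^ (k + 1) = \<theta> * (x / real d ^ k) + \<theta>' * (x / real d) + \<theta> * \<theta>'"
    using d0 by (simp add: \<theta>_def \<theta>'_def field_simps power2_eq_square)
  also have "\<bar>\<dots>\<bar> \<le> \<bar>\<theta>\<bar> * (x / real d ^ k) + \<bar>\<theta>'\<bar> * (x / real d) + \<bar>\<theta>\<bar> * \<bar>\<theta>'\<bar>"
    using x by (intro order_trans[OF abs_triangle_ineq] add_mono) (auto simp: abs_mult)
  also have "\<dots> \<le> 1 * (x / real d ^ k) + 1 * (x / real d) + 1 * 1"
    using th x by (intro add_mono mult_mono) auto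
  also have "\<dots> \<le> 2 * x / real d + 1" using dk by simp
  finally have main: "\<bar>real (card X) * real (card Y) - x\<^sup>2 / real d ^ (k + 1)\<bar> \<le> 2 * x / real d + 1" .
  have "real (card X) + real (card Y) \<le> 2 * x / real d + 2"
    using X(2) Y(2) dk by simp
  also have "\<dots> \<le> 2 * (2 * x / real d + 1)"
  proof -
    have "0 \<le> 2 * x / real d" using x by (intro divide_nonneg_nonneg) auto
    thus ?thesis unfolding distrib_left by linarith
  qed
  finally have "real (card S) * (real (card X) + real (card Y)) \<le> real (card S) * (2 * (2 * x / real d + 1))"
    by (intro mult_left_mono) auto
  \<comment> \<open>The deleted lines account for \<open>2 * card S\<close> in the constant, the
    rounding errors for the remaining 1.\<close>
  hence "\<bar>real (solution_count A) - x\<^sup>2 / real d ^ (k + 1)\<bar> \<le> real (card S) * (2 * (2 * x / real d + 1)) + (2 * x / real d + 1)"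
    using main s by linarith
  also have "\<dots> = (2 * real (card S) + 1) * (2 * x / real d + 1)" by (simp add: algebra_simps)
  finally show ?thesis .
qed

text \<open>After families that are not disjoint drop out, the error is the sum of the remainders
  \<open>2 * x / d + 1\<close>. The first part is a power of a harmonic sum, the second counts at
  most \<open>z ^ card S\<close> families.\<close>

lemma truncated_main_term:
  assumes z: "z \<ge> 1"
  shows "\<bar>(\<Sum>Q\<in>generic_points. \<Prod>P\<in>S. truncated_sum z P Q) -
     x\<^sup>2 * (\<Sum>A\<in>{A \<in> S \<rightarrow>\<^sub>E prime_sets z. disjoint_family_on A S}.
        \<Prod>P\<in>S. (-1) ^ card (A P) / real (\<Prod>(A P)) ^ (k + 1))\<bar>
     \<le> (2 * real (card S) + 1) * (2 * x * (1 + ln z) ^ card S + z ^ card S)"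
proof -
  let ?F = "{A \<in> S \<rightarrow>\<^sub>E prime_sets z. disjoint_family_on A S}"
  let ?s = "\<lambda>A. \<Prod>P\<in>S. (-1) ^ card (A P) :: real"
  let ?d = "\<lambda>A. \<Prod>P\<in>S. \<Prod>(A P)"
  let ?c = "2 * real (card S) + 1"
  have finP: "finite (S \<rightarrow>\<^sub>E prime_sets z)" using finS finite_prime_sets by (intro finite_PiE) auto
  have "(\<Sum>Q\<in>generic_points. \<Prod>P\<in>S. truncated_sum z P Q) = (\<Sum>A\<in>?F. ?s A * real (solution_count A))"
    unfolding sum_prod_truncated_sum
    by (rule sum.mono_neutral_right) (use finP solution_count_not_disjoint in auto)
  moreover have "x\<^sup>2 * (\<Sum>A\<in>?F. \<Prod>P\<in>S. (-1) ^ card (A P) / real (\<Prod>(A P)) ^ (k + 1)) =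
      (\<Sum>A\<in>?F. ?s A * (x\<^sup>2 / real (?d A) ^ (k + 1)))"
    unfolding sum_distrib_left
  proof (rule sum.cong[OF refl])
    fix A
    have "real (?d A) ^ (k + 1) = (\<Prod>P\<in>S. real (\<Prod>(A P)) ^ (k + 1))"
      by (simp only: of_nat_prod prod_power_distrib)
    thus "x\<^sup>2 * (\<Prod>P\<in>S. (-1) ^ card (A P) / real (\<Prod>(A P)) ^ (k + 1)) = ?s A * (x\<^sup>2 / real (?d A) ^ (k + 1))"
      by (simp only: prod_dividef times_divide_eq_right mult.commute)
  qed
  ultimately have "(\<Sum>Q\<in>generic_points. \<Prod>P\<in>S. truncated_sum z P Q) -
     x\<^sup>2 * (\<Sum>A\<in>?F. \<Prod>P\<in>S. (-1) ^ card (A P) / real (\<Prod>(A P)) ^ (k + 1)) =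
     (\<Sum>A\<in>?F. ?s A * (real (solution_count A) - x\<^sup>2 / real (?d A) ^ (k + 1)))"
    by (simp only: sum_subtractf right_diff_distrib)
  also have "\<bar>\<dots>\<bar> \<le> (\<Sum>A\<in>?F. ?c * (2 * x / real (?d A) + 1))"
  proof (rule order_trans[OF sum_abs], rule sum_mono)
    fix A assume A: "A \<in> ?F"
    have "\<bar>?s A\<bar> = 1" by (simp add: abs_prod power_abs)
    thus "\<bar>?s A * (real (solution_count A) - x\<^sup>2 / real (?d A) ^ (k + 1))\<bar> \<le> ?c * (2 * x / real (?d A) + 1)"
      using solution_count_disjoint[of A z] A by (simp only: abs_mult mem_Collect_eq mult_1)
  qed
  \<comment> \<open>The nonnegative remainders are summed over all families again, so that the sum
    factors over the points.\<close>
  also have "\<dots> \<le> (\<Sum>A\<in>S \<rightarrow>\<^sub>E prime_sets z. ?c * (2 * x / real (?d A) + 1))"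
  proof (rule sum_mono2[OF finP])
    fix A
    have "2 * x / real (?d A) \<ge> 0" using x by (intro divide_nonneg_nonneg) linarith+
    thus "0 \<le> ?c * (2 * x / real (?d A) + 1)" by (intro mult_nonneg_nonneg) linarith+
  qed auto
  also have "\<dots> = ?c * (2 * x * (\<Sum>A\<in>S \<rightarrow>\<^sub>E prime_sets z. 1 / real (?d A)) + real (card (S \<rightarrow>\<^sub>E prime_sets z)))"
    by (simp add: sum.distrib flip: sum_distrib_left sum_divide_distrib)
       (simp add: sum_distrib_left)
  also have "\<dots> \<le> ?c * (2 * x * (1 + ln z) ^ card S + z ^ card S)"
  proof (intro mult_left_mono add_mono)
    have "(\<Sum>A\<in>S \<rightarrow>\<^sub>E prime_sets z. 1 / real (?d A)) = (\<Sum>A\<in>S \<rightarrow>\<^sub>E prime_sets z. \<Prod>P\<in>S. 1 / real (\<Prod>(A P)))"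
      by (simp add: prod_dividef)
    also have "\<dots> = (\<Prod>P\<in>S. \<Sum>A\<in>prime_sets z. 1 / real (\<Prod>A))"
      using finS finite_prime_sets by (intro prod_sum_PiE[symmetric]) auto
    also have "\<dots> = (\<Sum>A\<in>prime_sets z. 1 / real (\<Prod>A)) ^ card S" by (rule prod_constant)
    also have "\<dots> \<le> (1 + ln z) ^ card S"
      using sum_prime_sets_inverse_le[OF z] by (intro power_mono sum_nonneg divide_nonneg_nonneg of_nat_0_le_iff zero_le_one)
    finally show "(\<Sum>A\<in>S \<rightarrow>\<^sub>E prime_sets z. 1 / real (?d A)) \<le> (1 + ln z) ^ card S" .
    have "real (card (S \<rightarrow>\<^sub>E prime_sets z)) = real (card (prime_sets z)) ^ card S"
      using finS by (simp add: card_PiE)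
    also have "\<dots> \<le> z ^ card S" using card_prime_sets_le[of z] z by (intro power_mono) auto
    finally show "real (card (S \<rightarrow>\<^sub>E prime_sets z)) \<le> z ^ card S" .
  qed (use x in auto)
  finally show ?thesis .
qed

text \<open>The four summands come, in order, from the horizontal lines through \<open>S\<close>,
  from truncating the signed sums, from the remainders of the congruence counts and from the tail of
  the Euler product.\<close>

lemma visible_error_le:
  assumes z: "z \<ge> 1" and B: "B \<ge> 1"
    "\<And>P Q. P \<in> S \<Longrightarrow> Q \<in> generic_points \<Longrightarrow> 2 ^ card (blocking_primes k P Q) \<le> B"
  shows "\<bar>visible_error k S x\<bar> \<le> real (card S) * x +
    (1 + B ^ card S) * (\<Sum>P\<in>S. real (card {Q \<in> generic_points. real (\<Prod>(blocking_primes k P Q)) > z})) +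
    (2 * real (card S) + 1) * (2 * x * (1 + ln z) ^ card S + z ^ card S) +
    x\<^sup>2 * (2 * real (card S) * 3 ^ card S / z ^ k)"
proof -
  let ?G = "\<Sum>Q\<in>generic_points. \<Prod>P\<in>S. full_sum P Q"
  let ?T = "\<Sum>Q\<in>generic_points. \<Prod>P\<in>S. truncated_sum z P Q"
  let ?M = "\<Sum>A\<in>{A \<in> S \<rightarrow>\<^sub>E prime_sets z. disjoint_family_on A S}.
        \<Prod>P\<in>S. (-1) ^ card (A P) / real (\<Prod>(A P)) ^ (k + 1)"
  let ?I = "\<Prod>p::nat. if prime p then 1 - real (card S) / real p ^ (k + 1) else 1"
  let ?c = "1 + B ^ card S"
  have "\<bar>?G - ?T\<bar> \<le> (\<Sum>Q\<in>generic_points. \<bar>(\<Prod>P\<in>S. full_sum P Q) - (\<Prod>P\<in>S. truncated_sum z P Q)\<bar>)"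
    unfolding sum_subtractf[symmetric] by (rule sum_abs)
  also have "\<dots> \<le> (\<Sum>Q\<in>generic_points. \<Sum>P\<in>S. if real (\<Prod>(blocking_primes k P Q)) > z then ?c else 0)"
    using B by (intro sum_mono truncation_error)
  also have "\<dots> = (\<Sum>P\<in>S. \<Sum>Q\<in>generic_points. if real (\<Prod>(blocking_primes k P Q)) > z then ?c else 0)"
    by (rule sum.swap)
  also have "\<dots> = (\<Sum>P\<in>S. ?c * real (card {Q \<in> generic_points. real (\<Prod>(blocking_primes k P Q)) > z}))"
    using finite_generic_points by (intro sum.cong refl) (simp add: sum.If_cases Int_def mult.commute)
  also have "\<dots> = ?c * (\<Sum>P\<in>S. real (card {Q \<in> generic_points. real (\<Prod>(blocking_primes k P Q)) > z}))"
    by (rule sum_distrib_left[symmetric])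
  finally have 1: "\<bar>?G - ?T\<bar> \<le> \<dots>" .
  have "\<bar>?I - ?M\<bar> \<le> 2 * real (card S) * 3 ^ card S / z ^ k"
    using finS k z by (intro prodinf_primes_tail) auto
  hence "x\<^sup>2 * \<bar>?I - ?M\<bar> \<le> x\<^sup>2 * (2 * real (card S) * 3 ^ card S / z ^ k)"
    by (rule mult_left_mono) simp
  hence 2: "\<bar>x\<^sup>2 * ?M - x\<^sup>2 * ?I\<bar> \<le> x\<^sup>2 * (2 * real (card S) * 3 ^ card S / z ^ k)"
    by (simp only: right_diff_distrib[symmetric] abs_mult abs_power2 abs_minus_commute)
  show ?thesis
    using 1 2 visible_count_approx truncated_main_term[OF z] unfolding visible_error_def by linarith
qed

subsection \<open>Choice of the truncation level\<close>

lemma visible_error_few_points: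
  assumes N: "1 \<le> card S" "card S \<le> k"
  shows "\<bar>visible_error k S x\<bar> \<le> 4 ^ k * (real k + (2 * real k + 1) * 4 + real k * 3 ^ k) * (x * ln x ^ card S)"
proof -
  define N where "N = card S"
  define z where "z = (2 * x) powr (1 / real k)"
  have N': "1 \<le> N" "N \<le> k" using N by (auto simp: N_def)
  have z1: "z \<ge> 1" unfolding z_def using x k by (intro ge_one_powr_ge_zero) auto
  have zk: "z ^ k = 2 * x" unfolding z_def using x k by (simp add: powr_powr flip: powr_realpow)
  \<comment> \<open>The factor \<open>B\<close> will multiply counts of empty sets, so the crude
    exponent 1 suffices.\<close>
  obtain C where C: "C \<ge> 1" "\<And>Q :: nat set. finite Q \<Longrightarrow> (\<And>p. p \<in> Q \<Longrightarrow> prime p) \<Longrightarrow> 2 ^ card Q \<le> C * real (\<Prod>Q) powr 1"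
    using two_power_card_primes_le[of 1] by auto
  have B: "2 ^ card (blocking_primes k P Q) \<le> C * (2 * x)" if "P \<in> S" "Q \<in> generic_points" for P Q
  proof -
    have "2 ^ card (blocking_primes k P Q) \<le> C * real (\<Prod>(blocking_primes k P Q)) powr 1"
      by (intro C(2) finite_blocking_primes that prime_blocking_primes)
    also have "\<dots> = C * real (\<Prod>(blocking_primes k P Q))" by (simp del: of_nat_prod)
    also have "\<dots> \<le> C * (2 * x)" using C(1) prod_blocking_primes_le(1)[OF that(2,1)] by (intro mult_left_mono) auto
    finally show ?thesis .
  qed
  have B1: "C * (2 * x) \<ge> 1" using C(1) x mult_mono[of 1 C 1 "2 * x"] by simp
  have "{Q \<in> generic_points. real (\<Prod>(blocking_primes k P Q)) > z} = {}" if "P \<in> S" for P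
    using no_large_blocking[OF that z1 eq_refl[OF zk[symmetric]]] by blast
  hence "(\<Sum>P\<in>S. real (card {Q \<in> generic_points. real (\<Prod>(blocking_primes k P Q)) > z})) = (\<Sum>P\<in>S. 0)"
    by (intro sum.cong refl) (simp only: card.empty of_nat_0)
  hence "\<bar>visible_error k S x\<bar> \<le> real N * x + (2 * real N + 1) * (2 * x * (1 + ln z) ^ N + z ^ N) +
      x\<^sup>2 * (2 * real N * 3 ^ N / z ^ k)"
    using visible_error_le[OF z1 B1 B] unfolding N_def by (simp only: sum.neutral_const) simp
  also have "x\<^sup>2 * (2 * real N * 3 ^ N / z ^ k) = real N * 3 ^ N * x"
    using x by (simp add: zk power2_eq_square)
  finally have e: "\<bar>visible_error k S x\<bar> \<le> real N * x + (2 * real N + 1) * (2 * x * (1 + ln z) ^ N + z ^ N) + real N * 3 ^ N * x" .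
  \<comment> \<open>\<open>L = (4 * ln x) ^ N\<close> dominates both 1 and
    \<open>(1 + ln z) ^ N\<close>, because \<open>ln x \<ge> 1 / 2\<close>.\<close>
  define L where "L = 4 ^ N * ln x ^ N"
  have ln2: "ln x \<ge> 1 / 2"
  proof -
    have "(1::real) / 2 \<le> ln 2" using ln2_ge_two_thirds by linarith
    also have "\<dots> \<le> ln x" using x by simp
    finally show ?thesis .
  qed
  have L1: "1 \<le> L"
    unfolding L_def power_mult_distrib[symmetric] using ln2 by (intro one_le_power) linarith
  have "ln z = ln (2 * x) / real k" unfolding z_def using x by (simp add: ln_powr)
  also have "\<dots> \<le> ln (2 * x)" using x k ln_ge_zero[of "2 * x"] by (simp add: divide_le_eq mult_le_cancel_left1)
  also have "\<dots> = ln 2 + ln x" using x by (simp add: ln_mult)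
  also have "\<dots> \<le> 2 * ln x" using x by simp
  finally have "1 + ln z \<le> 4 * ln x" using ln2 by linarith
  hence lz: "(1 + ln z) ^ N \<le> L"
    unfolding L_def power_mult_distrib[symmetric] using z1 by (intro power_mono) auto
  \<comment> \<open>Here \<open>N \<le> k\<close> keeps the number of families linear in
    \<open>x\<close>.\<close>
  have "z ^ N \<le> z ^ k" using z1 N' by (intro power_increasing)
  hence zN: "z ^ N \<le> 2 * x * L" using zk mult_left_mono[OF L1, of "2 * x"] x by linarith
  have xL: "x \<le> x * L" using L1 x by simp
  have "real N * x + (2 * real N + 1) * (2 * x * (1 + ln z) ^ N + z ^ N) + real N * 3 ^ N * x
     \<le> real N * (x * L) + (2 * real N + 1) * (2 * x * L + 2 * x * L) + real N * 3 ^ N * (x * L)"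
    using xL lz zN x by (intro add_mono mult_left_mono) auto
  also have "\<dots> = (real N + (2 * real N + 1) * 4 + real N * 3 ^ N) * (4 ^ N * (x * ln x ^ N))"
    by (simp add: L_def algebra_simps)
  also have "\<dots> \<le> (real k + (2 * real k + 1) * 4 + real k * 3 ^ k) * (4 ^ k * (x * ln x ^ N))"
  proof -
    have "(3::real) ^ N \<le> 3 ^ k" "(4::real) ^ N \<le> 4 ^ k" using N' by (auto intro: power_increasing)
    thus ?thesis using N' ln2 x by (intro mult_mono add_mono) auto
  qed
  finally show ?thesis using e by (simp add: N_def mult_ac)
qed

text \<open>The coefficient is stated with \<open>M\<close> in place of \<open>card S\<close>, and
  \<open>\<delta>\<close> and \<open>C\<close> are parameters, so that one coefficient serves all
  \<open>S\<close> and \<open>x\<close>.\<close>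

lemma visible_error_many_points:
  fixes \<epsilon> \<delta> C :: real
  assumes N: "k < card S" "card S < 2 ^ (k + 1)" and \<delta>: "\<delta> > 0" "\<delta> * 2 ^ (k + 1) \<le> \<epsilon>"
    and C: "C \<ge> 1" "\<And>Q :: nat set. finite Q \<Longrightarrow> (\<And>p. p \<in> Q \<Longrightarrow> prime p) \<Longrightarrow> 2 ^ card Q \<le> C * real (\<Prod>Q) powr \<delta>"
  defines "M \<equiv> 2 ^ (k + 1)"
  shows "\<bar>visible_error k S x\<bar> \<le>
    (real M + (1 + C ^ M * 2 powr \<epsilon>) * (18 * real M) + (2 * real M + 1) * (2 * (1 + 1 / \<delta>) ^ M + 1) +
      2 * real M * 3 ^ M) * x powr (2 - 2 * real k / (real (card S) + real k) + \<epsilon>)"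
proof -
  define N where "N = card S"
  define e where "e = 2 - 2 * real k / (real N + real k)"
  define z where "z = x powr (2 / (real N + real k))"
  define X where "X = x powr (e + \<epsilon>)"
  have NM: "N \<le> M" "k < N" using N by (auto simp: N_def M_def)
  have eps: "\<epsilon> > 0" using \<delta> by (smt (verit) mult_pos_pos zero_less_power)
  \<comment> \<open>An \<open>N\<close>-th power of \<open>x powr \<delta>\<close> thus costs at
    most \<open>x powr \<epsilon>\<close>.\<close>
  have \<delta>N: "\<delta> * real N \<le> \<epsilon>"
  proof -
    have "real M = 2 ^ (k + 1)" unfolding M_def by simp
    moreover have "\<delta> * real N \<le> \<delta> * real M" using NM(1) \<delta>(1) by (intro mult_left_mono) auto
    ultimately show ?thesis using \<delta>(2) by simp
  qed
  \<comment> \<open>As \<open>e = 2 * N / (N + k)\<close>, this is where \<open>N > k\<close> is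
    used; it lets \<open>x powr e\<close> absorb the terms linear in \<open>x\<close>.\<close>
  have e1: "e \<ge> 1" using NM k by (simp add: e_def field_simps)
  have z1: "z \<ge> 1" unfolding z_def using x by (intro ge_one_powr_ge_zero) auto
  have zpow: "z ^ j = x powr (2 * real j / (real N + real k))" for j
    unfolding z_def using x by (simp add: powr_powr flip: powr_realpow)
  have e2: "2 * real N / (real N + real k) = e" using NM by (simp add: e_def field_simps)
  have zN: "z ^ N = x powr e" unfolding zpow e2 ..
  have zk: "x\<^sup>2 / z ^ k = x powr e"
  proof -
    have "x\<^sup>2 = x powr 2" using x by simp
    thus ?thesis unfolding zpow e_def by (simp only: powr_diff)
  qed
  have xe: "x powr e \<le> X" unfolding X_def using x eps by (intro powr_mono) auto
  have xx: "x \<le> X"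
  proof -
    have "x powr 1 \<le> x powr (e + \<epsilon>)" using x eps e1 by (intro powr_mono) auto
    thus ?thesis using x by (simp add: X_def)
  qed
  define B where "B = C * (2 * x) powr \<delta>"
  have B: "2 ^ card (blocking_primes k P Q) \<le> B" if "P \<in> S" "Q \<in> generic_points" for P Q
  proof -
    have "2 ^ card (blocking_primes k P Q) \<le> C * real (\<Prod>(blocking_primes k P Q)) powr \<delta>"
      by (intro C(2) finite_blocking_primes that prime_blocking_primes)
    also have "\<dots> \<le> B" unfolding B_def
      using C(1) \<delta>(1) prod_blocking_primes_le(1)[OF that(2,1)] by (intro mult_left_mono powr_mono2) (auto simp del: of_nat_prod)
    finally show ?thesis .
  qed
  have "1 \<le> (2 * x) powr \<delta>" using x \<delta> by (intro ge_one_powr_ge_zero) auto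
  hence B1: "B \<ge> 1" unfolding B_def using C(1) mult_mono[of 1 C 1 "(2 * x) powr \<delta>"] by simp
  have BN: "B ^ N \<le> C ^ M * 2 powr \<epsilon> * x powr \<epsilon>"
  proof -
    have "B ^ N = C ^ N * (2 * x) powr (\<delta> * real N)"
      unfolding B_def power_mult_distrib using x by (simp add: powr_powr flip: powr_realpow)
    also have "\<dots> \<le> C ^ M * (2 * x) powr \<epsilon>"
      using C(1) NM \<delta>N x by (intro mult_mono power_increasing powr_mono) auto
    finally show ?thesis using x by (simp add: powr_mult)
  qed
  have ex: "x powr \<epsilon> \<ge> 1" using x eps by (intro ge_one_powr_ge_zero) auto
  have XX: "x powr \<epsilon> * x powr e = X" unfolding X_def by (simp add: powr_add)
  have t2: "(1 + B ^ N) * (\<Sum>P\<in>S. real (card {Q \<in> generic_points. real (\<Prod>(blocking_primes k P Q)) > z}))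
      \<le> (1 + C ^ M * 2 powr \<epsilon>) * (18 * real M) * X"
  proof -
    have "(\<Sum>P\<in>S. real (card {Q \<in> generic_points. real (\<Prod>(blocking_primes k P Q)) > z})) \<le> (\<Sum>P\<in>S. 18 * x\<^sup>2 / z ^ k)"
      by (intro sum_mono card_large_blocking_le z1)
    also have "\<dots> = 18 * real N * (x\<^sup>2 / z ^ k)" by (simp add: N_def)
    also have "\<dots> \<le> 18 * real M * x powr e" unfolding zk using NM by (intro mult_right_mono) auto
    finally have s: "(\<Sum>P\<in>S. real (card {Q \<in> generic_points. real (\<Prod>(blocking_primes k P Q)) > z})) \<le> 18 * real M * x powr e" .
    have "1 + B ^ N \<le> (1 + C ^ M * 2 powr \<epsilon>) * x powr \<epsilon>" using BN ex by (simp add: algebra_simps)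
    hence "(1 + B ^ N) * (\<Sum>P\<in>S. real (card {Q \<in> generic_points. real (\<Prod>(blocking_primes k P Q)) > z}))
      \<le> ((1 + C ^ M * 2 powr \<epsilon>) * x powr \<epsilon>) * (18 * real M * x powr e)"
      using s C(1) by (intro mult_mono) (auto intro!: sum_nonneg)
    also have "\<dots> = (1 + C ^ M * 2 powr \<epsilon>) * (18 * real M) * X" unfolding XX[symmetric] by (simp only: mult_ac)
    finally show ?thesis .
  qed
  have lz: "(1 + ln z) ^ N \<le> (1 + 1 / \<delta>) ^ M * x powr \<epsilon>"
  proof -
    have lnx: "ln x \<ge> 0" using x by simp
    have "ln z = 2 / (real N + real k) * ln x" unfolding z_def using x by (simp add: ln_powr)
    also have "\<dots> \<le> 1 * ln x" using k lnx by (intro mult_right_mono) auto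
    finally have "ln z \<le> ln x" by simp
    \<comment> \<open>\<open>ln y \<le> y - 1\<close> at \<open>y = x powr \<delta>\<close> trades
      the logarithm for a small power.\<close>
    moreover have "\<delta> * ln x \<le> x powr \<delta> - 1"
      using ln_le_minus_one[of "x powr \<delta>"] x by (simp add: ln_powr)
    hence "ln x \<le> (x powr \<delta> - 1) / \<delta>" using \<delta> by (simp add: field_simps)
    moreover have "1 \<le> x powr \<delta>" using x \<delta> by (intro ge_one_powr_ge_zero) auto
    moreover have "(x powr \<delta> - 1) / \<delta> \<le> x powr \<delta> / \<delta>" using \<delta> by (intro divide_right_mono) auto
    ultimately have "1 + ln z \<le> x powr \<delta> + x powr \<delta> / \<delta>" by linarith
    also have "\<dots> = (1 + 1 / \<delta>) * x powr \<delta>" by (simp add: algebra_simps)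
    finally have "(1 + ln z) ^ N \<le> ((1 + 1 / \<delta>) * x powr \<delta>) ^ N" using z1 by (intro power_mono) auto
    also have "\<dots> = (1 + 1 / \<delta>) ^ N * x powr (\<delta> * real N)"
      using x by (simp add: power_mult_distrib powr_powr flip: powr_realpow)
    also have "\<dots> \<le> (1 + 1 / \<delta>) ^ M * x powr \<epsilon>"
      using \<delta>N \<delta> NM x by (intro mult_mono power_increasing powr_mono) auto
    finally show ?thesis .
  qed
  have t3: "(2 * real N + 1) * (2 * x * (1 + ln z) ^ N + z ^ N) \<le> (2 * real M + 1) * (2 * (1 + 1 / \<delta>) ^ M + 1) * X"
  proof -
    have "x * (1 + ln z) ^ N \<le> x powr e * ((1 + 1 / \<delta>) ^ M * x powr \<epsilon>)"
    proof (rule mult_mono[OF _ lz])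
      show "x \<le> x powr e" using powr_mono[of 1 e x] x e1 by simp
    qed (use z1 in auto)
    also have "\<dots> = (1 + 1 / \<delta>) ^ M * X" unfolding XX[symmetric] by (simp only: mult_ac)
    finally have "2 * x * (1 + ln z) ^ N + z ^ N \<le> 2 * ((1 + 1 / \<delta>) ^ M * X) + X"
      using xe unfolding zN by linarith
    also have "\<dots> = (2 * (1 + 1 / \<delta>) ^ M + 1) * X" by (simp add: algebra_simps)
    finally have "2 * x * (1 + ln z) ^ N + z ^ N \<le> (2 * (1 + 1 / \<delta>) ^ M + 1) * X" .
    hence "(2 * real N + 1) * (2 * x * (1 + ln z) ^ N + z ^ N) \<le> (2 * real M + 1) * ((2 * (1 + 1 / \<delta>) ^ M + 1) * X)"
      using NM z1 x by (intro mult_mono) auto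
    thus ?thesis by (simp only: mult_ac)
  qed
  have t4: "x\<^sup>2 * (2 * real N * 3 ^ N / z ^ k) \<le> 2 * real M * 3 ^ M * X"
  proof -
    have "x\<^sup>2 * (2 * real N * 3 ^ N / z ^ k) = 2 * real N * 3 ^ N * (x\<^sup>2 / z ^ k)" by simp
    also have "\<dots> \<le> 2 * real M * 3 ^ M * X"
      unfolding zk using NM xe by (intro mult_mono power_increasing) auto
    finally show ?thesis .
  qed
  have t1: "real N * x \<le> real M * X" using NM xx x by (intro mult_mono) auto
  have "\<bar>visible_error k S x\<bar> \<le> real M * X + (1 + C ^ M * 2 powr \<epsilon>) * (18 * real M) * X +
     (2 * real M + 1) * (2 * (1 + 1 / \<delta>) ^ M + 1) * X + 2 * real M * 3 ^ M * X"
    using visible_error_le[OF z1 B1 B] t1 t2 t3 t4 unfolding N_def by linarith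
  thus ?thesis unfolding X_def e_def N_def by (simp only: distrib_right)
qed

end

section \<open>From large \<open>x\<close> to all \<open>x \<ge> 2\<close>\<close>

text \<open>Below the size \<open>X\<close> of \<open>S\<close>, the trivial bound by the area of
  the square and the main term is at most a constant depending on \<open>S\<close>. The lower bound
  \<open>c\<close> for \<open>g\<close> turns it into a multiple of \<open>g x\<close>.\<close>

lemma visible_error_bound_extend:
  fixes g :: "real \<Rightarrow> real"
  assumes S: "finite S" and c: "c > 0" "\<And>x. x \<ge> 2 \<Longrightarrow> g x \<ge> c"
    and bnd: "\<And>x. x \<ge> 2 \<Longrightarrow> (\<forall>(u, v)\<in>S. \<bar>of_int u\<bar> \<le> x \<and> \<bar>of_int v\<bar> \<le> x) \<Longrightarrow> \<bar>visible_error k S x\<bar> \<le> C * g x"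
  shows "\<exists>C'. \<forall>x\<ge>2. \<bar>visible_error k S x\<bar> \<le> C' * g x"
proof -
  let ?I = "\<Prod>p::nat. if prime p then 1 - real (card S) / real p ^ (k + 1) else 1"
  define X :: real where "X = (\<Sum>(u, v)\<in>S. \<bar>of_int u\<bar> + \<bar>of_int v\<bar>)"
  define K where "K = X\<^sup>2 * (1 + \<bar>?I\<bar>) / c"
  have K0: "K \<ge> 0" using c by (simp add: K_def)
  have "\<bar>visible_error k S x\<bar> \<le> (\<bar>C\<bar> + K) * g x" if x: "x \<ge> 2" for x
  proof (cases "x \<ge> X")
    case True
    have "\<bar>of_int u\<bar> \<le> x \<and> \<bar>of_int v\<bar> \<le> x" if "(u, v) \<in> S" for u v
    proof -
      have "(\<lambda>(u, v). \<bar>of_int u\<bar> + \<bar>of_int v\<bar> :: real) (u, v) \<le> X"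
        unfolding X_def using S that by (intro member_le_sum) auto
      hence "\<bar>of_int u\<bar> + \<bar>of_int v\<bar> \<le> X" by simp
      thus ?thesis using True by linarith
    qed
    hence "\<bar>visible_error k S x\<bar> \<le> C * g x" using x by (intro bnd) auto
    also have "\<dots> \<le> (\<bar>C\<bar> + K) * g x" using K0 c(2)[OF x] c(1) by (intro mult_right_mono) auto
    finally show ?thesis .
  next
    case False
    have "{(m, n). (m, n) \<in> visible_set k S \<and> of_int m \<le> x \<and> of_int n \<le> x} \<subseteq> {1..\<lfloor>x\<rfloor>} \<times> {1..\<lfloor>x\<rfloor>}"
      by (auto simp: visible_set_def le_floor_iff)
    hence "visible_count k S x \<le> card ({1..\<lfloor>x\<rfloor>} \<times> {1..\<lfloor>x\<rfloor>})"
      unfolding visible_count_def by (intro card_mono) auto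
    also have "\<dots> = nat \<lfloor>x\<rfloor> * nat \<lfloor>x\<rfloor>" by (simp add: card_cartesian_product)
    also have "real \<dots> \<le> x * x" unfolding of_nat_mult using x by (intro mult_mono) linarith+
    finally have "real (visible_count k S x) \<le> x\<^sup>2" by (simp add: power2_eq_square)
    hence "\<bar>visible_error k S x\<bar> \<le> x\<^sup>2 + \<bar>x\<^sup>2 * ?I\<bar>" unfolding visible_error_def by linarith
    also have "\<dots> = x\<^sup>2 * (1 + \<bar>?I\<bar>)" by (simp add: abs_mult algebra_simps)
    also have "\<dots> \<le> X\<^sup>2 * (1 + \<bar>?I\<bar>)" using False x by (intro mult_right_mono power_mono) auto
    also have "\<dots> = K * c" using c by (simp add: K_def)
    also have "\<dots> \<le> (\<bar>C\<bar> + K) * g x" using K0 c(1) c(2)[OF x] by (intro mult_mono) auto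
    finally show ?thesis .
  qed
  thus ?thesis by blast
qed

text \<open>There are two constants for each bound: \<open>C\<close> is uniform in \<open>S\<close>
  once \<open>x\<close> dominates the coordinates, while \<open>C'\<close> may depend on
  \<open>S\<close> and covers all \<open>x \<ge> 2\<close>. Uniformity for all \<open>x\<close>
  fails already for one point: by the Chinese remainder theorem a distant point can be placed so
  that every point of a given square is blocked, and the error is then of order
  \<open>x ^ 2\<close>.\<close>

theorem theorem1:
  fixes k :: nat
  assumes "k \<ge> 2"
  shows
    "(\<exists>C. \<forall>S. finite S \<and> pairwise (k_visible k) S \<and> card S < 2 ^ (k + 1) \<and>
          1 \<le> card S \<and> card S \<le> k \<longrightarrow>
        (\<forall>x\<ge>2. (\<forall>(u, v)\<in>S. \<bar>of_int u\<bar> \<le> x \<and> \<bar>of_int v\<bar> \<le> x) \<longrightarrow>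
           \<bar>visible_error k S x\<bar> \<le> C * (x * ln x ^ card S)) \<and>
        (\<exists>C'. \<forall>x\<ge>2. \<bar>visible_error k S x\<bar> \<le> C' * (x * ln x ^ card S))) \<and>
     (\<forall>\<epsilon>>0. \<exists>C. \<forall>S. finite S \<and> pairwise (k_visible k) S \<and> card S < 2 ^ (k + 1) \<and>
          k < card S \<longrightarrow>
        (\<forall>x\<ge>2. (\<forall>(u, v)\<in>S. \<bar>of_int u\<bar> \<le> x \<and> \<bar>of_int v\<bar> \<le> x) \<longrightarrow>
           \<bar>visible_error k S x\<bar>
             \<le> C * x powr (2 - 2 * real k / (real (card S) + real k) + \<epsilon>)) \<and>
        (\<exists>C'. \<forall>x\<ge>2. \<bar>visible_error k S x\<bar>
             \<le> C' * x powr (2 - 2 * real k / (real (card S) + real k) + \<epsilon>)))"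
proof (rule conjI)
  let ?C = "4 ^ k * (real k + (2 * real k + 1) * 4 + real k * 3 ^ k)"
  show "\<exists>C. \<forall>S. finite S \<and> pairwise (k_visible k) S \<and> card S < 2 ^ (k + 1) \<and>
          1 \<le> card S \<and> card S \<le> k \<longrightarrow>
        (\<forall>x\<ge>2. (\<forall>(u, v)\<in>S. \<bar>of_int u\<bar> \<le> x \<and> \<bar>of_int v\<bar> \<le> x) \<longrightarrow>
           \<bar>visible_error k S x\<bar> \<le> C * (x * ln x ^ card S)) \<and>
        (\<exists>C'. \<forall>x\<ge>2. \<bar>visible_error k S x\<bar> \<le> C' * (x * ln x ^ card S))"
  proof (rule exI[of _ ?C], intro allI impI)
    fix S assume S: "finite S \<and> pairwise (k_visible k) S \<and> card S < 2 ^ (k + 1) \<and> 1 \<le> card S \<and> card S \<le> k"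
    have bnd: "\<bar>visible_error k S x\<bar> \<le> ?C * (x * ln x ^ card S)"
      if "x \<ge> 2" "\<forall>(u, v)\<in>S. \<bar>of_int u\<bar> \<le> x \<and> \<bar>of_int v\<bar> \<le> x" for x
    proof -
      interpret visible_family k S x
        by unfold_locales (use S that assms in auto)
      show ?thesis using S by (intro visible_error_few_points) auto
    qed
    have "\<exists>C'. \<forall>x\<ge>2. \<bar>visible_error k S x\<bar> \<le> C' * (x * ln x ^ card S)"
    proof (rule visible_error_bound_extend[OF _ _ _ bnd])
      \<comment> \<open>The lower bound is the value at \<open>x = 2\<close>, by
        monotonicity.\<close>
      show "2 * ln 2 ^ card S > (0::real)" by simp
      show "2 * ln 2 ^ card S \<le> x * ln x ^ card S" if "x \<ge> 2" for x :: real
        using that by (intro mult_mono power_mono) auto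
    qed (use S in auto)
    thus "(\<forall>x\<ge>2. (\<forall>(u, v)\<in>S. \<bar>of_int u\<bar> \<le> x \<and> \<bar>of_int v\<bar> \<le> x) \<longrightarrow>
           \<bar>visible_error k S x\<bar> \<le> ?C * (x * ln x ^ card S)) \<and>
        (\<exists>C'. \<forall>x\<ge>2. \<bar>visible_error k S x\<bar> \<le> C' * (x * ln x ^ card S))"
      using bnd by blast
  qed
next
  show "\<forall>\<epsilon>>0. \<exists>C. \<forall>S. finite S \<and> pairwise (k_visible k) S \<and> card S < 2 ^ (k + 1) \<and>
          k < card S \<longrightarrow>
        (\<forall>x\<ge>2. (\<forall>(u, v)\<in>S. \<bar>of_int u\<bar> \<le> x \<and> \<bar>of_int v\<bar> \<le> x) \<longrightarrow>
           \<bar>visible_error k S x\<bar>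
             \<le> C * x powr (2 - 2 * real k / (real (card S) + real k) + \<epsilon>)) \<and>
        (\<exists>C'. \<forall>x\<ge>2. \<bar>visible_error k S x\<bar>
             \<le> C' * x powr (2 - 2 * real k / (real (card S) + real k) + \<epsilon>))"
  proof (intro allI impI)
    fix \<epsilon> :: real assume eps: "\<epsilon> > 0"
    \<comment> \<open>The loss \<open>\<epsilon>\<close> is shared among fewer than
      \<open>2 ^ (k + 1)\<close> points.\<close>
    define \<delta> where "\<delta> = \<epsilon> / 2 ^ (k + 1)"
    have \<delta>: "\<delta> > 0" "\<delta> * 2 ^ (k + 1) \<le> \<epsilon>" using eps by (simp_all add: \<delta>_def)
    obtain C where C: "C \<ge> 1" "\<And>Q :: nat set. finite Q \<Longrightarrow> (\<And>p. p \<in> Q \<Longrightarrow> prime p) \<Longrightarrow> 2 ^ card Q \<le> C * real (\<Prod>Q) powr \<delta>"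
      using two_power_card_primes_le[OF \<delta>(1)] by blast
    define M :: nat where "M = 2 ^ (k + 1)"
    define K where "K = real M + (1 + C ^ M * 2 powr \<epsilon>) * (18 * real M) +
      (2 * real M + 1) * (2 * (1 + 1 / \<delta>) ^ M + 1) + 2 * real M * 3 ^ M"
    show "\<exists>C. \<forall>S. finite S \<and> pairwise (k_visible k) S \<and> card S < 2 ^ (k + 1) \<and>
          k < card S \<longrightarrow>
        (\<forall>x\<ge>2. (\<forall>(u, v)\<in>S. \<bar>of_int u\<bar> \<le> x \<and> \<bar>of_int v\<bar> \<le> x) \<longrightarrow>
           \<bar>visible_error k S x\<bar>
             \<le> C * x powr (2 - 2 * real k / (real (card S) + real k) + \<epsilon>)) \<and>
        (\<exists>C'. \<forall>x\<ge>2. \<bar>visible_error k S x\<bar>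
             \<le> C' * x powr (2 - 2 * real k / (real (card S) + real k) + \<epsilon>))"
    proof (rule exI[of _ K], intro allI impI)
      fix S assume S: "finite S \<and> pairwise (k_visible k) S \<and> card S < 2 ^ (k + 1) \<and> k < card S"
      let ?e = "2 - 2 * real k / (real (card S) + real k) + \<epsilon>"
      have bnd: "\<bar>visible_error k S x\<bar> \<le> K * x powr ?e"
        if "x \<ge> 2" "\<forall>(u, v)\<in>S. \<bar>of_int u\<bar> \<le> x \<and> \<bar>of_int v\<bar> \<le> x" for x
      proof -
        interpret visible_family k S x
          by unfold_locales (use S that assms in auto)
        show ?thesis unfolding K_def M_def
          using S by (intro visible_error_many_points \<delta> C) auto
      qed
      \<comment> \<open>A nonnegative exponent allows the lower bound \<open>c = 1\<close>.\<close>
      have "2 * real k / (real (card S) + real k) \<le> 2" using assms by (simp add: divide_le_eq)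
      hence e0: "?e \<ge> 0" using eps by linarith
      have "\<exists>C'. \<forall>x\<ge>2. \<bar>visible_error k S x\<bar> \<le> C' * x powr ?e"
      proof (rule visible_error_bound_extend[OF _ _ _ bnd])
        show "(0::real) < 1" by simp
        show "1 \<le> x powr ?e" if "x \<ge> 2" for x :: real
          using that e0 by (intro ge_one_powr_ge_zero) auto
      qed (use S in auto)
      thus "(\<forall>x\<ge>2. (\<forall>(u, v)\<in>S. \<bar>of_int u\<bar> \<le> x \<and> \<bar>of_int v\<bar> \<le> x) \<longrightarrow>
           \<bar>visible_error k S x\<bar> \<le> K * x powr ?e) \<and>
        (\<exists>C'. \<forall>x\<ge>2. \<bar>visible_error k S x\<bar> \<le> C' * x powr ?e)"
        using bnd by blast
    qed
  qed
qed

end
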